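(* Let $G$ be a topological group that is not locally compact, let $bG$ be a Hausdorff compactification of $G$, and let $Y = bG \setminus G$. If $Y$ has locally a $\delta\theta$-base, then $G$ and $bG$ are separable and metrizable.
   Context: All spaces (including topological groups) are assumed Hausdorff. A Hausdorff compactification $bG$ of $G$ is a compact Hausdorff space containing $G$ as a dense subspace. A space $X$ has locally a property $\Phi$ if for each $x \in X$ there is an open set $U$ with $x \in U$ such that the subspace $U$ has property $\Phi$. A collection $\mathcal{B} = \bigcup_{n \in \mathbb{N}} \mathcal{B}_n$ of open subsets of a space $X$ is a $\delta\theta$-base for $X$ if whenever $x \in U$ with $U$ open, there exist $n \in \mathbb{N}$ and $B \in \mathcal{B}_n$ such that (i) $1 \le \mathrm{ord}(x, \mathcal{B}_n) \le \omega$, and (ii) $x \in B \subset U$. Here $\mathrm{ord}(x,\mathcal{B}_n)$ is the cardinality of $\{B \in \mathcal{B}_n : x \in B\}$. *)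

theory Defs
  imports "HOL-Analysis.Analysis" "HOL-Algebra.Group"
begin

text \<open>All spaces are assumed to be Hausdorff, so this is built into topological groups.\<close>

locale topological_group = group G for G (structure) and T :: "'a topology" +
  assumes topspace_eq_carrier: "topspace T = carrier G"
    and Hausdorff: "Hausdorff_space T"
    and continuous_mult: "continuous_map (prod_topology T T) T (\<lambda>(x, y). x \<otimes> y)"
    and continuous_inv: "continuous_map T T (\<lambda>x. inv x)"

text \<open>The space \<open>X\<close> literally sits inside \<open>bX\<close>: its points are points of \<open>bX\<close>, and it carries
  the subspace topology.\<close>

definition Hausdorff_compactification :: "'a topology \<Rightarrow> 'a topology \<Rightarrow> bool" where
  "Hausdorff_compactification X bX \<longleftrightarrow>
     compact_space bX \<and> Hausdorff_space bX \<and>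
     topspace X \<subseteq> topspace bX \<and> subtopology bX (topspace X) = X \<and>
     bX closure_of (topspace X) = topspace bX"

definition has_locally :: "('a topology \<Rightarrow> bool) \<Rightarrow> 'a topology \<Rightarrow> bool" where
  "has_locally \<Phi> X \<longleftrightarrow>
     (\<forall>x \<in> topspace X. \<exists>U. openin X U \<and> x \<in> U \<and> \<Phi> (subtopology X U))"

text \<open>The order \<open>ord(x, \<B>)\<close> is the cardinality of \<open>members_at x \<B>\<close>; thus
  \<open>1 \<le> ord(x, \<B>) \<le> \<omega>\<close> says that this set is nonempty and countable (possibly finite).\<close>

definition members_at :: "'a \<Rightarrow> 'a set set \<Rightarrow> 'a set set" where
  "members_at x \<B> = {B \<in> \<B>. x \<in> B}"

definition delta_theta_base :: "'a topology \<Rightarrow> (nat \<Rightarrow> 'a set set) \<Rightarrow> bool" where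
  "delta_theta_base X \<B> \<longleftrightarrow>
     (\<forall>n. \<forall>B \<in> \<B> n. openin X B) \<and>
     (\<forall>U x. openin X U \<and> x \<in> U \<longrightarrow>
        (\<exists>n. \<exists>B \<in> \<B> n.
           members_at x (\<B> n) \<noteq> {} \<and> countable (members_at x (\<B> n)) \<and>
           x \<in> B \<and> B \<subseteq> U))"

definition has_delta_theta_base :: "'a topology \<Rightarrow> bool" where
  "has_delta_theta_base X \<longleftrightarrow> (\<exists>\<B>. delta_theta_base X \<B>)"

end

theory Submission
  imports Defs
begin

text \<open>The proof rests on one property of \<open>\<delta>\<theta>\<close>-bases: in a \<open>T\<^sub>1\<close>-space with such a base, only countably
  many of its members are responsible for the points of a compact subset, or more
  generally of a subset with a countable network modulo compact sets
  (\<open>countable_delta_theta_trace\<close>). Such a subset therefore has a countable outer base, that is, countably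
  many open sets that form a base at each of its points. This remains true if the \<open>\<delta>\<theta>\<close>-bases exist
  only locally (\<open>countable_outer_base_of_compact_network\<close>).

  Let \<open>Y\<close> be the remainder of \<open>G\<close> in \<open>bG\<close>. As \<open>G\<close> is not locally compact, both \<open>G\<close> and \<open>Y\<close> are dense in \<open>bG\<close>,
  so outer bases in \<open>Y\<close> extend to outer bases in \<open>bG\<close>. The set \<open>Y\<close> is not countably compact: a
  countably compact set with a \<open>\<delta>\<theta>\<close>-base is compact, by an argument of Wicke and Worrell, so that
  \<open>Y\<close> would be locally compact and hence open in \<open>bG\<close>, which the density of \<open>G\<close> excludes. So some countable subset of \<open>Y\<close> accumulates at a point of \<open>G\<close>
  but nowhere in \<open>Y\<close>. Since the points of \<open>Y\<close> have countable character in \<open>bG\<close>, this gives a countable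
  \<open>\<pi>\<close>-base at a point of \<open>G\<close>, and the group \<open>G\<close> is first countable (\<open>countable_base_at_one\<close>).

  If \<open>G\<close> were not separable, it would contain an uncountable set \<open>Z\<close> that is uniformly separated by some
  neighbourhood of the identity. The limit points of \<open>Z\<close> in \<open>bG\<close> form a compact subset of \<open>Y\<close>. It has a
  countable outer base, so it is the intersection of countably many open sets, each of which contains all but finitely
  many points of \<open>Z\<close>; thus \<open>Z\<close> is countable after all (\<open>separated_set_countable\<close>). So \<open>G\<close> is second
  countable. This makes \<open>Y\<close> a set with a countable network modulo compact sets, hence a set with a
  countable outer base. Together, \<open>G\<close> and \<open>Y\<close> yield a countable base of \<open>bG\<close>.\<close>

section \<open>Countability of the relevant part of a \<open>\<delta>\<theta>\<close>-base\<close>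

lemma maximal_independent_subset:
  fixes R :: "'a \<Rightarrow> 'a \<Rightarrow> bool"
  shows "\<exists>Z\<subseteq>A. pairwise (\<lambda>x y. \<not> R x y) Z \<and> (\<forall>a\<in>A - Z. \<exists>z\<in>Z. R z a \<or> R a z)"
proof -
  let ?\<A> = "{Z. Z \<subseteq> A \<and> pairwise (\<lambda>x y. \<not> R x y) Z}"
  have "\<exists>Z\<in>?\<A>. \<forall>W\<in>?\<A>. Z \<subseteq> W \<longrightarrow> W = Z"
  proof (rule subset_Zorn')
    fix C assume C: "subset.chain ?\<A> C"
    have "C \<subseteq> ?\<A> \<and> (\<forall>X\<in>C. \<forall>Y\<in>C. X \<subseteq> Y \<or> Y \<subseteq> X)"
      using C unfolding subset_chain_def .
    then have sub: "C \<subseteq> ?\<A>" and lin: "\<forall>X\<in>C. \<forall>Y\<in>C. X \<subseteq> Y \<or> Y \<subseteq> X"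
      by (rule conjunct1, rule conjunct2)
    have "pairwise (\<lambda>x y. \<not> R x y) (\<Union>C)"
    proof (rule pairwiseI)
      fix x y assume xy: "x \<in> \<Union>C" "y \<in> \<Union>C" "x \<noteq> y"
      then obtain X Y where XY: "X \<in> C" "Y \<in> C" "x \<in> X" "y \<in> Y" by blast
      then obtain W where W: "W \<in> C" "x \<in> W" "y \<in> W"
        using lin by blast
      with sub have "pairwise (\<lambda>x y. \<not> R x y) W" by blast
      then show "\<not> R x y"
        using W xy(3) unfolding pairwise_def by blast
    qed
    moreover have "\<Union>C \<subseteq> A"
      using sub by blast
    ultimately show "\<Union>C \<in> ?\<A>"
      by simp
  qed
  then obtain Z where "Z \<in> ?\<A>" and max: "\<forall>W\<in>?\<A>. Z \<subseteq> W \<longrightarrow> W = Z" ..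
  then have Z: "Z \<subseteq> A" "pairwise (\<lambda>x y. \<not> R x y) Z" by simp_all
  have "\<exists>z\<in>Z. R z a \<or> R a z" if "a \<in> A - Z" for a
  proof (rule ccontr)
    assume "\<not> ?thesis"
    then have "pairwise (\<lambda>x y. \<not> R x y) (insert a Z)"
      using Z(2) by (auto simp: pairwise_insert)
    then show False
      using bspec [OF max, of "insert a Z"] Z(1) that by blast
  qed
  then have "\<forall>a\<in>A - Z. \<exists>z\<in>Z. R z a \<or> R a z" ..
  with Z show ?thesis by (intro exI conjI)
qed

text \<open>A maximal disjoint subfamily \<open>\<D>\<close> decides between the two alternatives: by maximality every member
  of \<open>\<C>\<close> meets \<open>\<Union>\<D>\<close>, and this union is countable as soon as \<open>\<D>\<close> is.\<close>

lemma countable_transversal_or_uncountable_disjoint: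
  assumes fin: "\<And>K. K \<in> \<C> \<Longrightarrow> finite K"
    and ne: "{} \<notin> \<C>"
  obtains D where "countable D"
    "(\<forall>K\<in>\<C>. K \<inter> D \<noteq> {}) \<or> (\<exists>\<D>\<subseteq>\<C>. uncountable \<D> \<and> pairwise disjnt \<D>)"
proof -
  obtain \<D> where \<D>: "\<D> \<subseteq> \<C>" "pairwise (\<lambda>K L. \<not> \<not> disjnt K L) \<D>"
    and max: "\<forall>K \<in> \<C> - \<D>. \<exists>L\<in>\<D>. \<not> disjnt L K \<or> \<not> disjnt K L"
    using maximal_independent_subset [of \<C> "\<lambda>K L. \<not> disjnt K L"] by (elim exE conjE)
  have disj: "pairwise disjnt \<D>"
    using \<D>(2) by simp
  show thesis
  proof (cases "countable \<D>")
    case True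
    have "countable K" if "K \<in> \<D>" for K
      using that \<D>(1) fin by (blast intro: countable_finite)
    with True have "countable (\<Union>K\<in>\<D>. K)"
      by (rule countable_UN)
    then have "countable (\<Union>\<D>)" by simp
    moreover have "K \<inter> \<Union>\<D> \<noteq> {}" if "K \<in> \<C>" for K
    proof (cases "K \<in> \<D>")
      case True
      then have "K \<inter> \<Union>\<D> = K" by blast
      moreover have "K \<noteq> {}" using ne that by metis
      ultimately show ?thesis by simp
    next
      case False
      then obtain L where "L \<in> \<D>" "\<not> disjnt L K \<or> \<not> disjnt K L"
        using max \<open>K \<in> \<C>\<close> by blast
      then show ?thesis unfolding disjnt_def by blast
    qed
    ultimately show ?thesis
      by (intro that [of "\<Union>\<D>"] disjI1 ballI)
  next
    case False
    show ?thesis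
      by (rule that [of "{}"], simp, rule disjI2, rule exI [of _ \<D>]) (intro conjI \<D>(1) False disj)
  qed
qed

text \<open>Closing off: iterate the operation \<open>h\<close> on finite subsets \<open>\<omega>\<close> times, starting from the empty set.\<close>

lemma countable_set_closed_under:
  fixes h :: "'k set \<Rightarrow> 'b \<Rightarrow> 'k set"
  assumes "countable B" and h: "\<And>V b. countable (h V b)"
  shows "\<exists>M. countable M \<and> (\<forall>V b. finite V \<and> V \<subseteq> M \<and> b \<in> B \<longrightarrow> h V b \<subseteq> M)"
proof -
  define step where "step M = M \<union> (\<Union>V\<in>{V. finite V \<and> V \<subseteq> M}. \<Union>b\<in>B. h V b)" for M
  define M where "M k = (step ^^ k) {}" for k
  have M_Suc: "M (Suc k) = step (M k)" for k by (simp add: M_def)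
  have count: "countable (M k)" for k
  proof (induction k)
    case (Suc k)
    then have "countable {V. finite V \<and> V \<subseteq> M k}"
      by (rule countable_Collect_finite_subset)
    with Suc show ?case
      unfolding M_Suc step_def using assms by auto
  qed (simp add: M_def)
  have mono: "M i \<subseteq> M j" if "i \<le> j" for i j
    using that by (rule lift_Suc_mono_le [rotated]) (auto simp: M_Suc step_def)
  show ?thesis
  proof (intro exI conjI allI impI)
    show "countable (\<Union>k. M k)" using count by auto
    fix V b assume "finite V \<and> V \<subseteq> (\<Union>k. M k) \<and> b \<in> B"
    then have V: "finite V" "V \<subseteq> (\<Union>k. M k)" and b: "b \<in> B" by simp_all
    have "\<exists>k. V \<subseteq> M k" using V
    proof (induction V rule: finite_induct)
      case (insert v V)
      then obtain i j where "V \<subseteq> M i" "v \<in> M j" by auto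
      then have "insert v V \<subseteq> M (max i j)"
        using mono [of i "max i j"] mono [of j "max i j"] by auto
      then show ?case ..
    qed simp
    then obtain k where "V \<subseteq> M k" ..
    then have "h V b \<subseteq> M (Suc k)"
      using V b unfolding M_Suc step_def by blast
    then show "h V b \<subseteq> (\<Union>k. M k)" by blast
  qed
qed


text \<open>The members of a cover carry the index of the level from which they are taken. A set that belongs
  to several levels is thereby treated as several different objects, which matters because
  countability of the order is known level by level only.\<close>

definition tagged_covers :: "(nat \<Rightarrow> 'a set set) \<Rightarrow> nat set \<Rightarrow> 'a set \<Rightarrow> (nat \<times> 'a set) set set" where
  "tagged_covers \<B> J A = {K. finite K \<and> K \<noteq> {} \<and> K \<subseteq> Sigma J \<B> \<and> A \<subseteq> \<Union>(snd ` K)}"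

text \<open>A network modulo a cover by compact sets: the compact sets \<open>P\<close> cover \<open>S\<close>, and \<open>\<N>\<close> contains outer
  approximations of each of them. With \<open>\<N>\<close> countable, this is the defining property of a Lindelof
  \<open>\<Sigma>\<close>-space. A compact set \<open>S\<close> has the network \<open>{S}\<close>.\<close>

definition compact_network :: "'a topology \<Rightarrow> 'a set \<Rightarrow> 'a set set \<Rightarrow> bool" where
  "compact_network X S \<N> \<longleftrightarrow>
     (\<forall>p\<in>S. \<exists>P. p \<in> P \<and> compactin X P \<and>
        (\<forall>U. openin X U \<and> P \<subseteq> U \<longrightarrow> (\<exists>N\<in>\<N>. P \<subseteq> N \<and> N \<subseteq> U)))"

text \<open>The part of the base that is responsible for the points of \<open>S\<close>: the defining property of a
  \<open>\<delta>\<theta>\<close>-base selects, for a point of \<open>S\<close>, only sets of this kind.\<close>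

definition delta_theta_trace :: "'a set \<Rightarrow> (nat \<Rightarrow> 'a set set) \<Rightarrow> (nat \<times> 'a set) set" where
  "delta_theta_trace S \<B> =
     {(n, B). B \<in> \<B> n \<and> (\<exists>x\<in>S. x \<in> B \<and> countable (members_at x (\<B> n)))}"

text \<open>The combinatorial heart of the matter. Suppose that \<open>A\<close> were covered by finitely many members,
  from the levels in \<open>insert n I\<close>, none of which lies in \<open>M\<close>. Since this cover misses \<open>M\<close>, the
  hypothesis on \<open>M\<close> yields uncountably many pairwise disjoint finite covers of \<open>A\<close>, and \<open>x\<close> lies in a
  member of each of them. Only countably many of these members lie in \<open>M\<close> and only countably many
  are of level \<open>n\<close>, so some member of a level in \<open>I\<close> contains \<open>x\<close> and lies outside \<open>M\<close>. This
  contradicts the choice of \<open>x\<close>.\<close>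

lemma escape_one_more_level:
  assumes M: "countable M"
    and hit: "\<And>K. K \<in> tagged_covers \<B> (insert n I) A \<Longrightarrow> K \<inter> M \<noteq> {} \<or>
                 (\<exists>\<D> \<subseteq> tagged_covers \<B> (insert n I) A. uncountable \<D> \<and> pairwise disjnt \<D>)"
    and x: "x \<in> A" "countable (members_at x (\<B> n))"
    and avoid: "\<And>m B. m \<in> I \<Longrightarrow> B \<in> \<B> m \<Longrightarrow> x \<in> B \<Longrightarrow> (m, B) \<in> M"
    and K: "finite K" "K \<subseteq> Sigma (insert n I) \<B> - M"
  shows "\<not> A \<subseteq> \<Union>(snd ` K)"
proof
  assume "A \<subseteq> \<Union>(snd ` K)"
  with K x have "K \<in> tagged_covers \<B> (insert n I) A" "K \<inter> M = {}"
    by (auto simp: tagged_covers_def)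
  with hit obtain \<D> where \<D>: "\<D> \<subseteq> tagged_covers \<B> (insert n I) A" "uncountable \<D>" "pairwise disjnt \<D>"
    by blast
  have "\<exists>k\<in>L. x \<in> snd k" if "L \<in> \<D>" for L
    using \<D>(1) x(1) that by (fastforce simp: tagged_covers_def)
  then obtain c where c: "\<And>L. L \<in> \<D> \<Longrightarrow> c L \<in> L \<and> x \<in> snd (c L)" by metis
  have "inj_on c \<D>"
    using c \<D>(3) by (intro inj_onI) (metis disjnt_iff pairwiseD)
  moreover have "c ` \<D> \<subseteq> M \<union> Pair n ` members_at x (\<B> n)"
  proof clarify
    fix L m B assume L: "L \<in> \<D>" and eq: "(m, B) = c L" and new: "(m, B) \<notin> Pair n ` members_at x (\<B> n)"
    have "(m, B) \<in> Sigma (insert n I) \<B>" "x \<in> B"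
      using c [OF L] \<D>(1) L by (auto simp: tagged_covers_def simp flip: eq)
    then show "(m, B) \<in> M"
      using new avoid by (auto simp: members_at_def)
  qed
  then have "countable (c ` \<D>)"
    using M x(2) by (meson countable_Un countable_image countable_subset)
  ultimately show False
    using \<D>(2) countable_image_inj_on by blast
qed

text \<open>In the case of a point-countable base the usual argument closes off a countable family \<open>M\<close> and shows
  that it contains all members of the base. Here a member outside \<open>M\<close> may contain points
  at which its level has uncountable order, so \<open>M\<close> cannot be reached through a countable dense set.
  Instead \<open>M\<close> is closed under the passage from a set \<open>N - \<Union>V\<close>, with \<open>N\<close> in the network and \<open>V \<subseteq> M\<close>
  finite, to a countable transversal of its finite covers, whenever there is one.

  Given \<open>p\<close>, let \<open>Q {}\<close> be the set of those points of the compact set \<open>P\<close> around \<open>p\<close> that no member of \<open>M\<close>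
  separates from \<open>p\<close>. By compactness, a cover of \<open>Q {}\<close> by members outside \<open>M\<close> already covers some
  \<open>N - \<Union>V\<close>, so \<open>escape_one_more_level\<close> applies. Running through the levels one by one gives a point
  \<open>x\<close> of \<open>Q {}\<close> such that \<open>M\<close> contains every member through \<open>x\<close> from every level at which \<open>x\<close> has
  countable order. Then \<open>M\<close> contains a local base at \<open>x\<close>, and as \<open>M\<close> does not separate
  \<open>x\<close> from \<open>p\<close>, the two points coincide. So \<open>M\<close> contains the part of the base that is responsible
  for \<open>p\<close>.\<close>

proposition countable_delta_theta_trace:
  assumes T1: "t1_space X" and base: "delta_theta_base X \<B>"
    and "countable \<N>" and net: "compact_network X S \<N>"
  shows "countable (delta_theta_trace S \<B>)"
proof -
  have opn: "openin X B" if "B \<in> \<B> n" for n B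
    using base that by (auto simp: delta_theta_base_def)
  define A where "A V N = N - \<Union>(snd ` V)" for V :: "(nat \<times> 'a set) set" and N
  define good where "good V N J D \<longleftrightarrow> countable D \<and> ((\<forall>K\<in>tagged_covers \<B> J (A V N). K \<inter> D \<noteq> {}) \<or>
          (\<exists>\<D>\<subseteq>tagged_covers \<B> J (A V N). uncountable \<D> \<and> pairwise disjnt \<D>))" for V N J D
  have ex_good: "\<exists>D. good V N J D" for V N J
  proof -
    have fin: "\<And>K. K \<in> tagged_covers \<B> J (A V N) \<Longrightarrow> finite K" and ne: "{} \<notin> tagged_covers \<B> J (A V N)"
      by (auto simp: tagged_covers_def)
    show ?thesis
      unfolding good_def by (rule countable_transversal_or_uncountable_disjoint [OF fin ne]) blast+
  qed
  define D where "D V N J = (SOME D. good V N J D)" for V N J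
  have D_good: "good V N J (D V N J)" for V N J
    unfolding D_def using ex_good by (rule someI_ex)
  then have D_count: "\<And>V N J. countable (D V N J)"
    and D: "\<And>V N J. (\<forall>K\<in>tagged_covers \<B> J (A V N). K \<inter> D V N J \<noteq> {}) \<or>
          (\<exists>\<D>\<subseteq>tagged_covers \<B> J (A V N). uncountable \<D> \<and> pairwise disjnt \<D>)"
    by (simp_all only: good_def)
  have "countable (\<N> \<times> {J :: nat set. finite J})"
    using \<open>countable \<N>\<close> countable_Collect_finite by blast
  then obtain M where M: "countable M"
    and closed: "\<forall>V b. finite V \<and> V \<subseteq> M \<and> b \<in> \<N> \<times> {J. finite J} \<longrightarrow> D V (fst b) (snd b) \<subseteq> M"
    using countable_set_closed_under [of "\<N> \<times> {J. finite J}" "\<lambda>V b. D V (fst b) (snd b)", OF _ D_count]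
    by (elim meta_impE exE conjE)
  have "(n, B) \<in> M" if p: "p \<in> S" and pn: "countable (members_at p (\<B> n))" and B: "p \<in> B" "B \<in> \<B> n" for p n B
  proof -
    obtain P where P: "p \<in> P" "compactin X P"
      and PN: "\<forall>U. openin X U \<and> P \<subseteq> U \<longrightarrow> (\<exists>N\<in>\<N>. P \<subseteq> N \<and> N \<subseteq> U)"
      using bspec [OF net [unfolded compact_network_def] p] by (elim exE conjE)
    \<comment> \<open>A point that lies in none of these sets is not separated from \<open>p\<close> by a member of \<open>M\<close>.\<close>
    define M' where "M' = {(m, B). (m, B) \<in> M \<and> B \<in> \<B> m \<and> p \<notin> B}"
    \<comment> \<open>At a point outside \<open>O' m\<close>, all members of level \<open>m\<close> through that point lie in \<open>M\<close>.\<close>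
    define O' where "O' m = \<Union>{B \<in> \<B> m. (m, B) \<notin> M}" for m
    define Q where "Q I = P - \<Union>(snd ` M') - \<Union>(O' ` I)" for I
    have O_open: "openin X (O' m)" for m
      unfolding O'_def using opn by blast
    have M'_open: "openin X (\<Union>(snd ` M'))"
      unfolding M'_def using opn by fastforce
    have Q_step: "Q (insert n I) \<noteq> {}" if I: "finite I" and x: "x \<in> Q I" "countable (members_at x (\<B> n))" for I n x
    proof
      assume empty: "Q (insert n I) = {}"
      define J where "J = insert n I"
      have P_cov: "P \<subseteq> \<Union>(snd ` (M' \<union> (Sigma J \<B> - M)))"
      proof
        fix y assume "y \<in> P"
        with empty consider "y \<in> \<Union>(snd ` M')" | m where "m \<in> J" "y \<in> O' m"
          unfolding Q_def J_def by blast
        then show "y \<in> \<Union>(snd ` (M' \<union> (Sigma J \<B> - M)))"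
        proof cases
          case 2
          then obtain B where "y \<in> B" "(m, B) \<in> Sigma J \<B> - M" unfolding O'_def by blast
          then show ?thesis by force
        qed auto
      qed
      have open_snd: "openin X (snd k)" if "k \<in> M' \<union> (Sigma J \<B> - M)" for k
        using that opn by (auto simp: M'_def)
      obtain \<F> where "finite \<F>" "\<F> \<subseteq> snd ` (M' \<union> (Sigma J \<B> - M))" "P \<subseteq> \<Union>\<F>"
        using compactinD [OF P(2) _ P_cov] open_snd by (metis (no_types, lifting) image_iff)
      then obtain W where W: "finite W" "W \<subseteq> M' \<union> (Sigma J \<B> - M)" "P \<subseteq> \<Union>(snd ` W)"
        by (metis finite_subset_image)
      have "openin X (\<Union>(snd ` W))"
        using W(2) open_snd by (intro openin_Union) auto
      with W(3) PN obtain N where N: "N \<in> \<N>" "P \<subseteq> N" "N \<subseteq> \<Union>(snd ` W)"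
        by auto
      have "\<not> A (W \<inter> M') N \<subseteq> \<Union>(snd ` (W - M'))"
      proof (rule escape_one_more_level [OF M])
        show "K \<inter> M \<noteq> {} \<or> (\<exists>\<D>\<subseteq>tagged_covers \<B> (insert n I) (A (W \<inter> M') N). uncountable \<D> \<and> pairwise disjnt \<D>)"
          if "K \<in> tagged_covers \<B> (insert n I) (A (W \<inter> M') N)" for K
        proof -
          have "D (W \<inter> M') N (insert n I) \<subseteq> M"
            using closed [rule_format, of "W \<inter> M'" "(N, insert n I)"] W(1) N(1) I by (auto simp: M'_def)
          then show ?thesis
            using D [of "insert n I" "W \<inter> M'" N] that by blast
        qed
        show "x \<in> A (W \<inter> M') N"
          using x(1) N(2) by (auto simp: A_def Q_def)
        show "(m, B) \<in> M" if "m \<in> I" "B \<in> \<B> m" "x \<in> B" for m B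
          using x(1) that by (auto simp: Q_def O'_def)
      qed (use W x in \<open>auto simp: J_def\<close>)
      then show False
        using N(3) by (auto simp: A_def)
    qed
    \<comment> \<open>The level \<open>n\<close> is added exactly if it has countable order at some point that is still available.
        A level that is not added has uncountable order at the final point, and imposes no condition there.\<close>
    define I where "I = rec_nat {} (\<lambda>n J. if \<exists>x\<in>Q J. countable (members_at x (\<B> n)) then insert n J else J)"
    have I_Suc: "I (Suc n) = (if \<exists>x\<in>Q (I n). countable (members_at x (\<B> n)) then insert n (I n) else I n)" for n
      by (simp add: I_def)
    have I: "finite (I n)" "Q (I n) \<noteq> {}" for n
    proof (induction n)
      case 0
      have "p \<in> Q {}"
        using P(1) by (auto simp: Q_def M'_def)
      then show "finite (I 0)" "Q (I 0) \<noteq> {}"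
        by (auto simp: I_def)
    next
      case (Suc n)
      then show "finite (I (Suc n))" "Q (I (Suc n)) \<noteq> {}"
        using Q_step unfolding I_Suc by auto
    qed
    have I_mono: "I i \<subseteq> I j" if "i \<le> j" for i j
      using that by (rule lift_Suc_mono_le [rotated]) (auto simp: I_Suc)
    have "\<exists>x. x \<in> Q (\<Union>n. I n)"
    proof (rule ccontr)
      assume "\<not> ?thesis"
      then have "y \<in> \<Union>(snd ` M') \<or> y \<in> \<Union>(O' ` (\<Union>n. I n))" if "y \<in> P" for y
        using that unfolding Q_def by blast
      then have cov: "P \<subseteq> \<Union>(insert (\<Union>(snd ` M')) (O' ` (\<Union>n. I n)))"
        unfolding Union_insert by blast
      have "openin X U" if "U \<in> insert (\<Union>(snd ` M')) (O' ` (\<Union>n. I n))" for U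
        using that O_open M'_open by (elim insertE imageE) simp_all
      then obtain \<F> where \<F>: "finite \<F>" "\<F> \<subseteq> insert (\<Union>(snd ` M')) (O' ` (\<Union>n. I n))" "P \<subseteq> \<Union>\<F>"
        using compactinD [OF P(2) _ cov] by (elim meta_impE exE conjE)
      then have "finite (\<F> - {\<Union>(snd ` M')})" "\<F> - {\<Union>(snd ` M')} \<subseteq> O' ` (\<Union>n. I n)" by auto
      then obtain J where J: "finite J" "J \<subseteq> (\<Union>n. I n)" "\<F> - {\<Union>(snd ` M')} = O' ` J"
        by (metis finite_subset_image)
      have "\<exists>k. J \<subseteq> I k" using J(1,2)
      proof (induction J rule: finite_induct)
        case (insert j J)
        then obtain a b where "J \<subseteq> I a" "j \<in> I b" by auto
        then have "insert j J \<subseteq> I (max a b)"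
          using I_mono [of a "max a b"] I_mono [of b "max a b"] by auto
        then show ?case ..
      qed simp
      then obtain k where "J \<subseteq> I k" ..
      obtain y where y: "y \<in> Q (I k)" using I(2) [of k] unfolding ex_in_conv [symmetric] ..
      then obtain T where T: "T \<in> \<F>" "y \<in> T" using \<F>(3) by (auto simp: Q_def)
      show False
      proof (cases "T = \<Union>(snd ` M')")
        case True
        then show ?thesis using y T(2) by (simp add: Q_def)
      next
        case False
        then have "T \<in> O' ` J" using T(1) J(3) by (metis Diff_iff singletonD)
        then show ?thesis using y T(2) \<open>J \<subseteq> I k\<close> by (auto simp: Q_def)
      qed
    qed
    then obtain x where x: "x \<in> Q (\<Union>n. I n)" ..
    have x_M: "(m, C) \<in> M" if "countable (members_at x (\<B> m))" "C \<in> \<B> m" "x \<in> C" for m C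
    proof -
      have "x \<in> Q (I m)"
        using x by (auto simp: Q_def)
      then have "m \<in> I (Suc m)"
        using that I_Suc by auto
      then show ?thesis
        using x that by (auto simp: Q_def O'_def)
    qed
    have "x \<in> topspace X" "p \<in> topspace X"
      using x P compactin_subset_topspace by (auto simp: Q_def)
    have "x = p"
    proof (rule ccontr)
      assume "x \<noteq> p"
      with T1 \<open>x \<in> topspace X\<close> \<open>p \<in> topspace X\<close> obtain U where "openin X U" "x \<in> U" "p \<notin> U"
        unfolding t1_space_def by metis
      then obtain m C where "C \<in> \<B> m" "countable (members_at x (\<B> m))" "x \<in> C" "C \<subseteq> U"
        using base unfolding delta_theta_base_def by meson
      then have "(m, C) \<in> M'"
        using x_M \<open>p \<notin> U\<close> by (auto simp: M'_def)
      then show False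
        using x \<open>x \<in> C\<close> by (force simp: Q_def)
    qed
    then show ?thesis
      using x_M pn B by blast
  qed
  then have "delta_theta_trace S \<B> \<subseteq> M"
    by (auto simp: delta_theta_trace_def)
  with M show ?thesis
    by (rule countable_subset [rotated])
qed

section \<open>Countable compactness\<close>

lemma delta_theta_baseD:
  assumes "delta_theta_base X \<B>" "openin X U" "x \<in> U"
  shows "\<exists>n. \<exists>B\<in>\<B> n. countable (members_at x (\<B> n)) \<and> x \<in> B \<and> B \<subseteq> U"
  using assms unfolding delta_theta_base_def by meson

text \<open>In a \<open>T\<^sub>1\<close>-space this is countable compactness of the set \<open>C\<close>.\<close>

definition limit_point_compact_in :: "'a topology \<Rightarrow> 'a set \<Rightarrow> bool" where
  "limit_point_compact_in X C \<longleftrightarrow> (\<forall>S \<subseteq> C. infinite S \<longrightarrow> C \<inter> X derived_set_of S \<noteq> {})"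

lemma t1_derived_set_of_infinite:
  assumes "t1_space X" "x \<in> X derived_set_of S" "openin X U" "x \<in> U"
  shows "infinite (S \<inter> U)"
proof -
  have "X derived_set_of S = {x \<in> topspace X. \<forall>U. x \<in> U \<and> openin X U \<longrightarrow> infinite (S \<inter> U)}"
    using t1_space_derived_set_of_infinite_openin [THEN iffD1, OF assms(1)] by (rule spec)
  with assms(2-4) show ?thesis by simp
qed

lemma limit_point_compact_nest:
  assumes "t1_space X" and C: "limit_point_compact_in X C"
    and F: "\<And>n. closedin X (F n)" "\<And>n. F n \<subseteq> C" "\<And>n. F n \<noteq> {}" "\<And>n. F (Suc n) \<subseteq> F n"
  shows "(\<Inter>n. F n) \<noteq> {}"
proof -
  have anti: "F j \<subseteq> F i" if "i \<le> j" for i j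
    using that by (rule lift_Suc_antimono_le [rotated]) (rule F(4))
  have "\<forall>n. \<exists>x. x \<in> F n" using F(3) by blast
  from choice [OF this] obtain x where "\<forall>n. x n \<in> F n" ..
  then have x: "x n \<in> F n" for n by simp
  show ?thesis
  proof (cases "finite (range x)")
    case True
    then obtain k where k: "infinite {n \<in> UNIV. x n = x k}"
      using pigeonhole_infinite [of UNIV x] by auto
    have "x k \<in> F n" for n
    proof -
      obtain m where "m \<ge> n" "x m = x k"
        using k unfolding infinite_nat_iff_unbounded_le by auto
      then show ?thesis
        using x [of m] anti [of n m] by auto
    qed
    then show ?thesis by blast
  next
    case False
    then obtain z where z: "z \<in> X derived_set_of (range x)"
    proof -
      have "range x \<subseteq> C" using x F(2) by blast
      with False C have "C \<inter> X derived_set_of range x \<noteq> {}"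
        unfolding limit_point_compact_in_def by simp
      then show ?thesis using that by blast
    qed
    have "z \<in> F n" for n
    proof (rule ccontr)
      assume "z \<notin> F n"
      moreover have "z \<in> topspace X"
        using z derived_set_of_subset_topspace [of X "range x"] by blast
      ultimately have "infinite (range x \<inter> (topspace X - F n))"
        using F(1) [of n] by (intro t1_derived_set_of_infinite [OF assms(1) z]) auto
      moreover have "range x \<inter> (topspace X - F n) \<subseteq> x ` {..<n}"
      proof clarify
        fix m assume "x m \<notin> F n"
        then have "m < n" using x [of m] anti [of n m] by (meson leI subsetD)
        then show "x m \<in> x ` {..<n}" by simp
      qed
      ultimately show False
        using finite_subset by blast
    qed
    then show ?thesis by blast
  qed
qed

definition countably_covered :: "'a set set \<Rightarrow> 'a set \<Rightarrow> bool" where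
  "countably_covered \<W> F \<longleftrightarrow> (\<exists>\<V>\<subseteq>\<W>. countable \<V> \<and> F \<subseteq> \<Union>\<V>)"

lemma countably_covered_Un:
  "countably_covered \<W> E \<Longrightarrow> countably_covered \<W> F \<Longrightarrow> countably_covered \<W> (E \<union> F)"
  unfolding countably_covered_def by (metis Sup_union_distrib Un_least Un_mono countable_Un)

lemma countably_covered_mono:
  "countably_covered \<W> F \<Longrightarrow> E \<subseteq> F \<Longrightarrow> countably_covered \<W> E"
  unfolding countably_covered_def by blast

lemma countably_covered_refine:
  assumes "countable \<U>" "\<And>U. U \<in> \<U> \<Longrightarrow> \<exists>W\<in>\<W>. U \<subseteq> W" "F \<subseteq> \<Union>\<U>"
  shows "countably_covered \<W> F"
proof -
  obtain w where "\<And>U. U \<in> \<U> \<Longrightarrow> w U \<in> \<W> \<and> U \<subseteq> w U" using assms(2) by metis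
  then show ?thesis
    using assms(1,3) unfolding countably_covered_def by (intro exI [of _ "w ` \<U>"]) fastforce
qed

text \<open>One step of the Wicke-Worrell argument: a closed set that is not countably covered contains another
  one that avoids all points at which \<open>\<U>\<close> has countable positive order. Either the part outside \<open>\<Union>\<U>\<close>
  serves, or it can be removed by countably many sets. In what remains, a maximal set \<open>Z\<close> of points
  of countable order of which no two lie in the same member of \<open>\<U>\<close> has no limit point, because each
  member of \<open>\<U>\<close> contains at most one point of \<open>Z\<close>. So \<open>Z\<close> is finite, and by maximality the countably many members
  of \<open>\<U>\<close> that meet \<open>Z\<close> cover all points of countable order.\<close>

lemma shrink_uncovered_set:
  assumes "t1_space X" and C: "limit_point_compact_in X C"
    and opn: "\<And>W. W \<in> \<W> \<Longrightarrow> openin X W"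
    and U: "\<And>U. U \<in> \<U> \<Longrightarrow> openin X U \<and> (\<exists>W\<in>\<W>. U \<subseteq> W)"
    and F: "closedin X F" "F \<subseteq> C" "\<not> countably_covered \<W> F"
  obtains F' where "closedin X F'" "F' \<subseteq> F" "\<not> countably_covered \<W> F'"
    "\<And>x. x \<in> F' \<Longrightarrow> \<not> (members_at x \<U> \<noteq> {} \<and> countable (members_at x \<U>))"
proof (cases "countably_covered \<W> (F - \<Union>\<U>)")
  case False
  have "closedin X (F - \<Union>\<U>)" using F(1) U by blast
  with False that show ?thesis by (force simp: members_at_def)
next
  case True
  then obtain \<V> where \<V>: "\<V> \<subseteq> \<W>" "countable \<V>" "F - \<Union>\<U> \<subseteq> \<Union>\<V>"
    by (auto simp: countably_covered_def)
  define H where "H = F - \<Union>\<V>"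
  have H: "closedin X H" "H \<subseteq> \<Union>\<U>" "H \<subseteq> C"
    unfolding H_def using F(1,2) \<V> opn by blast+
  obtain Z where Z: "Z \<subseteq> {x \<in> H. countable (members_at x \<U>)}"
    "pairwise (\<lambda>x y. \<not> (\<exists>U\<in>\<U>. x \<in> U \<and> y \<in> U)) Z"
    and max: "\<forall>a \<in> {x \<in> H. countable (members_at x \<U>)} - Z.
               \<exists>z\<in>Z. (\<exists>U\<in>\<U>. z \<in> U \<and> a \<in> U) \<or> (\<exists>U\<in>\<U>. a \<in> U \<and> z \<in> U)"
    using maximal_independent_subset [of "{x \<in> H. countable (members_at x \<U>)}" "\<lambda>x y. \<exists>U\<in>\<U>. x \<in> U \<and> y \<in> U"]
    by (elim exE conjE)
  have "finite Z"
  proof (rule ccontr)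
    assume "infinite Z"
    moreover have "Z \<subseteq> C" using Z(1) H(3) by blast
    ultimately obtain z where z: "z \<in> X derived_set_of Z"
      using C unfolding limit_point_compact_in_def by blast
    have "z \<in> H"
      using z H(1) Z(1) derived_set_of_mono [of Z H X] unfolding closedin_contains_derived_set by blast
    then obtain U where U': "U \<in> \<U>" "z \<in> U" using H(2) by blast
    have "infinite (Z \<inter> U)"
      using U' t1_derived_set_of_infinite [OF assms(1) z(1)] U by blast
    obtain a where a: "a \<in> Z \<inter> U"
      using infinite_imp_nonempty [OF \<open>infinite (Z \<inter> U)\<close>] unfolding ex_in_conv [symmetric] ..
    moreover obtain b where b: "b \<in> Z \<inter> U - {a}"
      using infinite_imp_nonempty [OF infinite_remove [OF \<open>infinite (Z \<inter> U)\<close>]] unfolding ex_in_conv [symmetric] ..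
    ultimately show False
      using Z(2) U'(1) unfolding pairwise_def by blast
  qed
  define \<E> where "\<E> = (\<Union>z\<in>Z. members_at z \<U>)"
  have "countable \<E>"
    unfolding \<E>_def using countable_finite [OF \<open>finite Z\<close>]
  proof (rule countable_UN)
    show "countable (members_at z \<U>)" if "z \<in> Z" for z
      using that Z(1) by blast
  qed
  have \<E>: "\<E> \<subseteq> \<U>" by (auto simp: \<E>_def members_at_def)
  show ?thesis
  proof
    show "closedin X (H - \<Union>\<E>)"
      using H(1) \<E> U by (intro closedin_diff openin_Union) auto
    show "H - \<Union>\<E> \<subseteq> F" by (auto simp: H_def)
    show "\<not> countably_covered \<W> (H - \<Union>\<E>)"
    proof
      assume "countably_covered \<W> (H - \<Union>\<E>)"
      moreover have "countably_covered \<W> (\<Union>\<E>)"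
        using countably_covered_refine [OF \<open>countable \<E>\<close> _ order_refl] \<E> U by (meson subsetD)
      moreover have "countably_covered \<W> (\<Union>\<V>)"
        using \<V> by (auto simp: countably_covered_def)
      ultimately have "countably_covered \<W> ((H - \<Union>\<E>) \<union> \<Union>\<E> \<union> \<Union>\<V>)"
        by (intro countably_covered_Un)
      then have "countably_covered \<W> F"
        by (rule countably_covered_mono) (auto simp: H_def)
      with F(3) show False by contradiction
    qed
    fix x assume x: "x \<in> H - \<Union>\<E>"
    show "\<not> (members_at x \<U> \<noteq> {} \<and> countable (members_at x \<U>))"
    proof
      assume a: "members_at x \<U> \<noteq> {} \<and> countable (members_at x \<U>)"
      then obtain U where "U \<in> \<U>" "x \<in> U" by (auto simp: members_at_def)
      then have "x \<notin> Z" using x by (auto simp: \<E>_def members_at_def)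
      then show False
        using bspec [OF max, of x] a x by (auto simp: \<E>_def members_at_def)
    qed
  qed
qed

text \<open>Every open cover is refined by the members of a \<open>\<delta>\<theta>\<close>-base that lie in one of its sets. If
  there were no countable subcover, the previous lemma, used for all levels in turn, would give a
  decreasing sequence of nonempty closed sets; a common point would have countable positive order at
  no level, although each point has it at some level.\<close>

proposition limit_point_compact_delta_theta_base_imp_compactin:
  assumes T1: "t1_space X" and base: "delta_theta_base X \<B>"
    and C: "closedin X C" "limit_point_compact_in X C"
  shows "compactin X C"
proof -
  have Lindelof: "countably_covered \<W> C" if W: "\<And>W. W \<in> \<W> \<Longrightarrow> openin X W" "C \<subseteq> \<Union>\<W>" for \<W>
  proof (rule ccontr)
    assume not: "\<not> countably_covered \<W> C"
    define \<U> where "\<U> n = {B \<in> \<B> n. \<exists>W\<in>\<W>. B \<subseteq> W}" for n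
    have U: "openin X U \<and> (\<exists>W\<in>\<W>. U \<subseteq> W)" if "U \<in> \<U> n" for U n
      using that base by (auto simp: \<U>_def delta_theta_base_def)
    define bad where "bad n F' \<longleftrightarrow> (\<forall>x\<in>F'. \<not> (members_at x (\<U> n) \<noteq> {} \<and> countable (members_at x (\<U> n))))" for n F'
    define ok where "ok F \<longleftrightarrow> closedin X F \<and> F \<subseteq> C \<and> \<not> countably_covered \<W> F" for F
    have "\<exists>F'. ok F' \<and> F' \<subseteq> F \<and> bad n F'" if "ok F" for F n
    proof -
      have F: "closedin X F" "F \<subseteq> C" "\<not> countably_covered \<W> F" using that by (auto simp: ok_def)
      show ?thesis
      proof (rule shrink_uncovered_set [OF T1 C(2) W(1) U F])
        fix F' assume "closedin X F'" "F' \<subseteq> F" "\<not> countably_covered \<W> F'"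
          and "\<And>x. x \<in> F' \<Longrightarrow> \<not> (members_at x (\<U> n) \<noteq> {} \<and> countable (members_at x (\<U> n)))"
        moreover from this(4) have "bad n F'"
          unfolding bad_def by (rule ballI)
        ultimately show "\<exists>F'. ok F' \<and> F' \<subseteq> F \<and> bad n F'"
          using F(2) unfolding ok_def by (intro exI [of _ F']) simp
      qed
    qed
    moreover have "ok C" using not C by (auto simp: ok_def)
    ultimately have "\<exists>F. \<forall>n. (ok (F n) \<and> (n = 0 \<longrightarrow> F n = C)) \<and> F (Suc n) \<subseteq> F n \<and> bad n (F (Suc n))"
      by (intro dependent_nat_choice) auto
    then obtain F where "\<forall>n. (ok (F n) \<and> (n = 0 \<longrightarrow> F n = C)) \<and> F (Suc n) \<subseteq> F n \<and> bad n (F (Suc n))" ..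
    then have F: "F 0 = C" "\<And>n. ok (F n)" "\<And>n. F (Suc n) \<subseteq> F n" "\<And>n. bad n (F (Suc n))"
      by simp_all
    have "F n \<noteq> {}" for n
      using F(2) [of n] by (auto simp: ok_def countably_covered_def)
    then have "(\<Inter>n. F n) \<noteq> {}"
      using F C(2) T1 by (intro limit_point_compact_nest [of X C]) (auto simp: ok_def)
    then obtain x where x: "\<And>n. x \<in> F n" by blast
    have "x \<in> C" using x [of 0] F(1) by simp
    with W(2) have "x \<in> \<Union>\<W>" by (rule subsetD)
    then obtain W where "W \<in> \<W>" "x \<in> W" by (rule UnionE)
    with delta_theta_baseD [OF base W(1)] have "\<exists>n. \<exists>B\<in>\<B> n. countable (members_at x (\<B> n)) \<and> x \<in> B \<and> B \<subseteq> W"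
      by simp
    then obtain n B where B: "B \<in> \<B> n" "countable (members_at x (\<B> n))" "x \<in> B" "B \<subseteq> W"
      by (elim exE bexE conjE)
    then have "B \<in> members_at x (\<U> n)"
      using \<open>W \<in> \<W>\<close> by (auto simp: members_at_def \<U>_def)
    moreover have "countable (members_at x (\<U> n))"
      by (rule countable_subset [OF _ B(2)]) (auto simp: members_at_def \<U>_def)
    ultimately show False
      using F(4) [of n] x [of "Suc n"] unfolding bad_def by blast
  qed
  show ?thesis
    unfolding compactin_def
  proof (intro conjI allI impI)
    show "C \<subseteq> topspace X" using C(1) closedin_subset by blast
    fix \<W> assume W: "(\<forall>W\<in>\<W>. openin X W) \<and> C \<subseteq> \<Union>\<W>"
    then obtain \<V> where \<V>: "\<V> \<subseteq> \<W>" "countable \<V>" "C \<subseteq> \<Union>\<V>"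
      using Lindelof [of \<W>] by (auto simp: countably_covered_def)
    show "\<exists>\<F>. finite \<F> \<and> \<F> \<subseteq> \<W> \<and> C \<subseteq> \<Union>\<F>"
    proof (rule ccontr)
      assume no: "\<not> ?thesis"
      then have "\<V> \<noteq> {}" using \<V> by auto
      define F where "F n = C - \<Union>(from_nat_into \<V> ` {..<n})" for n
      have V: "from_nat_into \<V> n \<in> \<V>" for n
        using \<open>\<V> \<noteq> {}\<close> by (rule from_nat_into)
      have "(\<Inter>n. F n) \<noteq> {}"
      proof (rule limit_point_compact_nest [OF T1 C(2)])
        show "closedin X (F n)" for n
          unfolding F_def using C(1) W V \<V>(1) by (intro closedin_diff) auto
        show "F n \<noteq> {}" for n
        proof
          assume "F n = {}"
          then have "C \<subseteq> \<Union>(from_nat_into \<V> ` {..<n})" unfolding F_def by blast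
          moreover have "from_nat_into \<V> ` {..<n} \<subseteq> \<W>" using V \<V>(1) by blast
          moreover have "finite (from_nat_into \<V> ` {..<n})" by simp
          ultimately show False using no by blast
        qed
        show "F (Suc n) \<subseteq> F n" for n
          unfolding F_def lessThan_Suc by blast
        show "F n \<subseteq> C" for n
          unfolding F_def by blast
      qed
      then obtain x where x: "\<forall>n. x \<in> F n" by blast
      then have "x \<in> C" by (simp add: F_def)
      then obtain V where "V \<in> \<V>" "x \<in> V" using \<V>(3) by blast
      then obtain n where "from_nat_into \<V> n = V"
        using from_nat_into_surj [OF \<V>(2)] by blast
      with spec [OF x, of "Suc n"] \<open>x \<in> V\<close> show False by (simp add: F_def lessThan_Suc)
    qed
  qed
qed

section \<open>Countable outer bases\<close>

lemma regular_space_shrink: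
  assumes "regular_space X" "openin X W" "x \<in> W"
  shows "\<exists>A. openin X A \<and> x \<in> A \<and> X closure_of A \<subseteq> W"
proof -
  have "closedin X (topspace X - W)" "x \<in> topspace X - (topspace X - W)"
    using assms(2,3) openin_subset by blast+
  with assms(1) obtain A where A: "openin X A" "x \<in> A" "disjnt (topspace X - W) (X closure_of A)"
    unfolding regular_space by meson
  then have "X closure_of A \<subseteq> W"
    using closure_of_subset_topspace [of X A] unfolding disjnt_def by blast
  with A show ?thesis by blast
qed

text \<open>Countably many Urysohn functions, one for each pair of basic sets of which one contains the closure of
  the other, separate the points, and embed the compact space into the metrizable space of real sequences.\<close>

lemma compact_Hausdorff_second_countable_imp_metrizable:
  assumes X: "compact_space X" "Hausdorff_space X" "second_countable X"
  shows "metrizable_space X"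
proof -
  obtain \<B> where \<B>: "countable \<B>" "\<forall>V\<in>\<B>. openin X V"
    "\<forall>U x. openin X U \<and> x \<in> U \<longrightarrow> (\<exists>V\<in>\<B>. x \<in> V \<and> V \<subseteq> U)"
    using X(3) unfolding second_countable_def by (elim exE conjE)
  have normal: "normal_space X"
    using X(1,2) by (simp add: compact_Hausdorff_or_regular_imp_normal_space)
  have regular: "regular_space X"
    using X(1,2) by (simp add: compact_Hausdorff_imp_regular_space)
  define sep where "sep U V f \<longleftrightarrow> continuous_map X euclideanreal f \<and>
      f ` (X closure_of U) \<subseteq> {0} \<and> f ` (topspace X - V) \<subseteq> {1}" for U V and f :: "'a \<Rightarrow> real"
  define I where "I = {(U, V). U \<in> \<B> \<and> V \<in> \<B> \<and> X closure_of U \<subseteq> V}"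
  have "countable I"
    by (rule countable_subset [of _ "\<B> \<times> \<B>"]) (use \<B>(1) in \<open>auto simp: I_def\<close>)
  have "\<exists>f. sep U V f" if "(U, V) \<in> I" for U V
  proof -
    have "closedin X (X closure_of U)" "closedin X (topspace X - V)" "disjnt (X closure_of U) (topspace X - V)"
      using that \<B>(2) by (auto simp: I_def disjnt_def)
    then obtain f where "continuous_map X euclideanreal f" "f ` (X closure_of U) \<subseteq> {0}" "f ` (topspace X - V) \<subseteq> {1}"
      using Urysohn_lemma_alt [OF normal] by blast
    then show ?thesis unfolding sep_def by blast
  qed
  then have "\<exists>f. sep (fst i) (snd i) f" if "i \<in> I" for i
    using that by (cases i) simp
  then obtain g where g: "\<forall>i\<in>I. sep (fst i) (snd i) (g i)"
    by metis
  define F where "F x k = (if from_nat_into I k \<in> I then g (from_nat_into I k) x else 0)" for x and k :: nat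
  have "continuous_map X euclideanreal (\<lambda>x. F x k)" for k
    using g by (cases "from_nat_into I k \<in> I") (simp_all add: F_def sep_def)
  then have "continuous_map X (product_topology (\<lambda>k. euclideanreal) UNIV) F"
    by (simp add: continuous_map_componentwise_UNIV)
  then have cont: "continuous_map X euclidean F"
    by (simp add: euclidean_product_topology)
  have "inj_on F (topspace X)"
  proof (rule inj_onI, rule ccontr)
    fix x y assume xy: "x \<in> topspace X" "y \<in> topspace X" "F x = F y" "x \<noteq> y"
    then obtain A where A: "openin X A" "x \<in> A" "y \<notin> A"
      using X(2) unfolding Hausdorff_space_def disjnt_def by blast
    then obtain V where V: "V \<in> \<B>" "x \<in> V" "V \<subseteq> A" using \<B>(3) by blast
    then have "openin X V" using \<B>(2) by blast
    then obtain W where W: "openin X W" "x \<in> W" "X closure_of W \<subseteq> V"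
      using regular_space_shrink [OF regular _ V(2)] by blast
    then obtain U where U: "U \<in> \<B>" "x \<in> U" "U \<subseteq> W" using \<B>(3) by blast
    have "(U, V) \<in> I"
      using U V W closure_of_mono [OF U(3), of X] by (auto simp: I_def)
    then obtain k where k: "from_nat_into I k = (U, V)"
      using from_nat_into_surj [OF \<open>countable I\<close>] by blast
    have "sep U V (g (U, V))" using bspec [OF g \<open>(U, V) \<in> I\<close>] by simp
    moreover have "x \<in> X closure_of U" using U(2) xy(1) closure_of_subset \<B>(2) U(1) openin_subset by (metis subsetD)
    moreover have "y \<in> topspace X - V" using V A xy by blast
    ultimately have "g (U, V) x = 0" "g (U, V) y = 1" by (auto simp: sep_def)
    moreover have "g (U, V) x = g (U, V) y"
      using fun_cong [OF xy(3), of k] \<open>(U, V) \<in> I\<close> by (simp add: F_def k)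
    ultimately show False by simp
  qed
  then have "embedding_map X euclidean F"
    using continuous_imp_closed_map [OF cont X(1)] cont
    by (intro injective_closed_imp_embedding_map) auto
  then have "X homeomorphic_space (subtopology euclidean (F ` topspace X))"
    by (rule embedding_map_imp_homeomorphic_space)
  then show ?thesis
    using homeomorphic_metrizable_space metrizable_space_subtopology metrizable_space_euclidean by blast
qed

text \<open>
  The levels of the single bases are kept apart: a level of the union is a pair of a set in \<open>\<U>\<close> and a
  level of its base, so that no order increases.
\<close>

lemma has_delta_theta_base_Union:
  assumes "countable \<U>" and U: "\<And>U. U \<in> \<U> \<Longrightarrow> openin X U \<and> has_delta_theta_base (subtopology X U)"
  shows "has_delta_theta_base (subtopology X (\<Union>\<U>))"
proof (cases "\<U> = {}")
  case True
  then show ?thesis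
    by (auto simp: has_delta_theta_base_def delta_theta_base_def intro: exI [of _ "\<lambda>_. {}"])
next
  case False
  have "\<forall>U\<in>\<U>. \<exists>\<B>. delta_theta_base (subtopology X U) \<B>"
    using U unfolding has_delta_theta_base_def by simp
  from bchoice [OF this] obtain \<B> where B_all: "\<forall>U\<in>\<U>. delta_theta_base (subtopology X U) (\<B> U)" ..
  then have \<B>: "delta_theta_base (subtopology X U) (\<B> U)" if "U \<in> \<U>" for U
    using that by (rule bspec)
  define \<C> where "\<C> k = \<B> (from_nat_into \<U> (fst (prod_decode k))) (snd (prod_decode k))" for k
  have "delta_theta_base (subtopology X (\<Union>\<U>)) \<C>"
    unfolding delta_theta_base_def
  proof (intro conjI allI impI ballI)
    fix k B assume B: "B \<in> \<C> k"
    define V where "V = from_nat_into \<U> (fst (prod_decode k))"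
    have V: "V \<in> \<U>" unfolding V_def using False by (rule from_nat_into)
    with \<B> B have "openin (subtopology X V) B"
      unfolding delta_theta_base_def \<C>_def V_def by blast
    then show "openin (subtopology X (\<Union>\<U>)) B"
      using U [OF V] V openin_trans_full [of X V B] openin_subset [of "subtopology X V" B]
      by (metis Sup_upper inf.absorb_iff2 le_inf_iff openin_subtopology_Int2 topspace_subtopology)
  next
    fix W x assume Wx: "openin (subtopology X (\<Union>\<U>)) W \<and> x \<in> W"
    then have "x \<in> \<Union>\<U>" using openin_subset by fastforce
    then obtain V where V: "V \<in> \<U>" "x \<in> V" by blast
    have "openin X (\<Union>\<U>)" using U by blast
    then have "openin X W" using Wx openin_trans_full by blast
    then have "openin (subtopology X V) (V \<inter> W)" by (rule openin_subtopology_Int2)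
    then obtain n B where B: "B \<in> \<B> V n" "countable (members_at x (\<B> V n))" "x \<in> B" "B \<subseteq> V \<inter> W"
      using delta_theta_baseD [OF \<B> [OF V(1)], of "V \<inter> W" x] V(2) Wx by blast
    obtain i where i: "from_nat_into \<U> i = V"
      using from_nat_into_surj [OF \<open>countable \<U>\<close> V(1)] by blast
    have "\<C> (prod_encode (i, n)) = \<B> V n" by (simp add: \<C>_def i)
    moreover have "members_at x (\<B> V n) \<noteq> {}" using B unfolding members_at_def by blast
    ultimately have "\<exists>B\<in>\<C> (prod_encode (i, n)). members_at x (\<C> (prod_encode (i, n))) \<noteq> {} \<and>
        countable (members_at x (\<C> (prod_encode (i, n)))) \<and> x \<in> B \<and> B \<subseteq> W"
      using B by (simp only:) blast
    then show "\<exists>n. \<exists>B\<in>\<C> n. members_at x (\<C> n) \<noteq> {} \<and> countable (members_at x (\<C> n)) \<and> x \<in> B \<and> B \<subseteq> W"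
      by (rule exI)
  qed
  then show ?thesis unfolding has_delta_theta_base_def by blast
qed

text \<open>Countably many open sets of the whole space that form a base at each point of \<open>S\<close>. This is stronger than
  second countability of the subspace \<open>S\<close>.\<close>

definition countable_outer_base :: "'a topology \<Rightarrow> 'a set \<Rightarrow> 'a set set \<Rightarrow> bool" where
  "countable_outer_base X S \<E> \<longleftrightarrow> countable \<E> \<and> (\<forall>B\<in>\<E>. openin X B) \<and>
     (\<forall>x\<in>S. \<forall>W. openin X W \<and> x \<in> W \<longrightarrow> (\<exists>B\<in>\<E>. x \<in> B \<and> B \<subseteq> W))"

lemma countable_outer_baseD:
  assumes "countable_outer_base X S \<E>"
  shows "countable \<E>" "B \<in> \<E> \<Longrightarrow> openin X B"
    "x \<in> S \<Longrightarrow> openin X W \<Longrightarrow> x \<in> W \<Longrightarrow> \<exists>B\<in>\<E>. x \<in> B \<and> B \<subseteq> W"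
  using assms unfolding countable_outer_base_def by simp_all

text \<open>A countable network modulo compact sets makes \<open>S\<close> Lindelof, so countably many of the open sets
  that have a \<open>\<delta>\<theta>\<close>-base suffice to cover \<open>S\<close>. Their union has a \<open>\<delta>\<theta>\<close>-base, and the
  part of it that is responsible for \<open>S\<close> is countable.\<close>

lemma countable_outer_base_of_compact_network:
  assumes T1: "t1_space X" and loc: "has_locally has_delta_theta_base X"
    and "countable \<N>" and net: "compact_network X S \<N>"
  shows "\<exists>\<E>. countable_outer_base X S \<E>"
proof -
  define good where "good U \<longleftrightarrow> openin X U \<and> has_delta_theta_base (subtopology X U)" for U
  define small where "small N \<U> \<longleftrightarrow> finite \<U> \<and> Ball \<U> good \<and> N \<subseteq> \<Union>\<U>" for N \<U>
  have "\<exists>\<U>. finite \<U> \<and> Ball \<U> good \<and> (\<forall>\<V>. small N \<V> \<longrightarrow> N \<subseteq> \<Union>\<U>)" for N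
  proof (cases "\<exists>\<V>. small N \<V>")
    case True
    then obtain \<V> where "small N \<V>" ..
    then show ?thesis by (intro exI [of _ \<V>]) (simp add: small_def)
  next
    case False
    then show ?thesis by (intro exI [of _ "{}"]) simp
  qed
  then have "\<forall>N. \<exists>\<U>. finite \<U> \<and> Ball \<U> good \<and> (\<forall>\<V>. small N \<V> \<longrightarrow> N \<subseteq> \<Union>\<U>)" ..
  from choice [OF this] obtain u
    where u_all: "\<forall>N. finite (u N) \<and> Ball (u N) good \<and> (\<forall>\<V>. small N \<V> \<longrightarrow> N \<subseteq> \<Union>(u N))" ..
  then have u: "finite (u N)" "Ball (u N) good" for N
    by simp_all
  have u_cover: "N \<subseteq> \<Union>(u N)" if "small N \<V>" for N \<V>
    using u_all that by blast
  define \<U> where "\<U> = (\<Union>N\<in>\<N>. u N)"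
  have "countable \<U>"
    unfolding \<U>_def using \<open>countable \<N>\<close>
    by (rule countable_UN) (simp add: countable_finite u(1))
  have \<U>: "openin X U \<and> has_delta_theta_base (subtopology X U)" if "U \<in> \<U>" for U
    using that u(2) unfolding \<U>_def good_def by blast
  define V where "V = \<Union>\<U>"
  have "openin X V" unfolding V_def using \<U> by blast
  obtain \<B> where \<B>: "delta_theta_base (subtopology X V) \<B>"
    using has_delta_theta_base_Union [OF \<open>countable \<U>\<close> \<U>] unfolding V_def has_delta_theta_base_def by blast
  have sub_net: "\<exists>P. p \<in> P \<and> compactin (subtopology X V) P \<and>
        (\<forall>U. openin (subtopology X V) U \<and> P \<subseteq> U \<longrightarrow> (\<exists>N\<in>\<N>. P \<subseteq> N \<and> N \<subseteq> U))" if p: "p \<in> S" for p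
  proof -
    obtain P where P: "p \<in> P" "compactin X P"
      and PN: "\<forall>U. openin X U \<and> P \<subseteq> U \<longrightarrow> (\<exists>N\<in>\<N>. P \<subseteq> N \<and> N \<subseteq> U)"
      using bspec [OF net [unfolded compact_network_def] p] by (elim exE conjE)
    have "P \<subseteq> \<Union>{U. good U}"
    proof
      fix x assume "x \<in> P"
      then have "x \<in> topspace X" using compactin_subset_topspace [OF P(2)] by blast
      with loc show "x \<in> \<Union>{U. good U}" unfolding has_locally_def good_def by blast
    qed
    moreover have "openin X U" if "U \<in> {U. good U}" for U
      using that by (simp add: good_def)
    ultimately have "\<exists>\<F>. finite \<F> \<and> \<F> \<subseteq> {U. good U} \<and> P \<subseteq> \<Union>\<F>"
      using compactinD [OF P(2), of "{U. good U}"] by simp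
    then obtain \<F> where \<F>: "finite \<F>" "\<F> \<subseteq> {U. good U}" "P \<subseteq> \<Union>\<F>"
      by (elim exE conjE)
    then have "openin X (\<Union>\<F>)" unfolding good_def by (intro openin_Union) auto
    with PN \<F>(3) obtain N where N: "N \<in> \<N>" "P \<subseteq> N" "N \<subseteq> \<Union>\<F>" by auto
    then have "small N \<F>" using \<F> by (auto simp: small_def)
    then have "N \<subseteq> \<Union>(u N)" by (rule u_cover)
    also have "\<dots> \<subseteq> V" using N(1) unfolding V_def \<U>_def by blast
    finally have "P \<subseteq> V" using N(2) by (rule order_trans [rotated])
    show ?thesis
    proof (intro exI [of _ P] conjI allI impI)
      show "compactin (subtopology X V) P"
        using P(2) \<open>P \<subseteq> V\<close> by (simp add: compactin_subtopology)
      fix U assume "openin (subtopology X V) U \<and> P \<subseteq> U"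
      then show "\<exists>N\<in>\<N>. P \<subseteq> N \<and> N \<subseteq> U"
        using PN openin_trans_full \<open>openin X V\<close> by blast
    qed (rule P(1))
  qed
  then have "compact_network (subtopology X V) S \<N>"
    unfolding compact_network_def by (rule ballI)
  then have count: "countable (delta_theta_trace S \<B>)"
    using countable_delta_theta_trace [OF t1_space_subtopology [OF T1] \<B> \<open>countable \<N>\<close>] by blast
  have "countable_outer_base X S (snd ` delta_theta_trace S \<B>)"
    unfolding countable_outer_base_def
  proof (intro conjI ballI allI impI)
    show "countable (snd ` delta_theta_trace S \<B>)" using count by simp
    fix B assume "B \<in> snd ` delta_theta_trace S \<B>"
    then have "openin (subtopology X V) B"
      using \<B> by (auto simp: delta_theta_trace_def delta_theta_base_def)
    then show "openin X B" using openin_trans_full \<open>openin X V\<close> by blast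
  next
    fix x W assume x: "x \<in> S" and W: "openin X W \<and> x \<in> W"
    obtain P where "x \<in> P" "compactin (subtopology X V) P"
      using sub_net [OF x] by (elim exE conjE)
    then have "x \<in> V" by (auto simp: compactin_subtopology)
    moreover have "openin (subtopology X V) (V \<inter> W)"
      using W by (simp add: openin_subtopology_Int2)
    ultimately obtain n B where B: "B \<in> \<B> n" "countable (members_at x (\<B> n))" "x \<in> B" "B \<subseteq> V \<inter> W"
      using delta_theta_baseD [OF \<B>, of "V \<inter> W" x] W by blast
    then have "(n, B) \<in> delta_theta_trace S \<B>"
      using x by (auto simp: delta_theta_trace_def)
    then have "B \<in> snd ` delta_theta_trace S \<B>" by force
    with B(3,4) show "\<exists>B\<in>snd ` delta_theta_trace S \<B>. x \<in> B \<and> B \<subseteq> W" by blast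
  qed
  then show ?thesis by blast
qed

text \<open>An open set \<open>W\<close> of \<open>X\<close> lies in the closure of its trace on the dense set \<open>D\<close>. Hence, by regularity, a
  small basic set of the subspace \<open>D\<close> extends to a small open set of \<open>X\<close>.\<close>

lemma countable_outer_base_dense_extension:
  assumes X: "regular_space X" and D: "X closure_of D = topspace X"
    and \<E>: "countable_outer_base (subtopology X D) S \<E>" and "S \<subseteq> D"
  shows "\<exists>\<E>'. countable_outer_base X S \<E>'"
proof -
  have "\<exists>O'. openin X O' \<and> O' \<inter> D = B" if "B \<in> \<E>" for B
    using countable_outer_baseD(2) [OF \<E> that] by (auto simp: openin_subtopology)
  then obtain e where e: "\<forall>B\<in>\<E>. openin X (e B) \<and> e B \<inter> D = B"
    by metis
  have "countable_outer_base X S (e ` \<E>)"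
    unfolding countable_outer_base_def
  proof (intro conjI ballI allI impI)
    show "countable (e ` \<E>)" using countable_outer_baseD(1) [OF \<E>] by simp
    show "openin X B" if "B \<in> e ` \<E>" for B using that e by blast
    fix x W assume x: "x \<in> S" and W: "openin X W \<and> x \<in> W"
    then obtain A where A: "openin X A" "x \<in> A" and clA: "X closure_of A \<subseteq> W"
      using regular_space_shrink [OF X] by blast
    have "openin (subtopology X D) (D \<inter> A)" using A(1) by (rule openin_subtopology_Int2)
    moreover have "x \<in> D \<inter> A" using A(2) x assms(4) by blast
    ultimately obtain B where B: "B \<in> \<E>" "x \<in> B" "B \<subseteq> D \<inter> A"
      using countable_outer_baseD(3) [OF \<E> x] by blast
    have eB: "openin X (e B)" "e B \<inter> D = B" using e B(1) by blast+
    have "e B \<subseteq> X closure_of (e B \<inter> X closure_of D)"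
      using eB(1) D by (metis closure_of_subset inf.absorb1 openin_subset)
    also have "\<dots> = X closure_of B"
      using closure_of_openin_Int_closure_of [OF eB(1), of D] eB(2) by simp
    also have "\<dots> \<subseteq> X closure_of A"
      using B(3) by (intro closure_of_mono) blast
    finally have "e B \<subseteq> W" using clA by blast
    moreover have "x \<in> e B" using eB(2) B(2) by blast
    ultimately show "\<exists>B\<in>e ` \<E>. x \<in> B \<and> B \<subseteq> W" using B(1) by blast
  qed
  then show ?thesis by blast
qed

text \<open>The outer base provides countably many open neighbourhoods \<open>\<Union>\<F>\<close> of the compact derived set, and each of them misses
  only finitely many points of \<open>Z\<close>. Every point of \<open>Z\<close> is missed by one of them.\<close>

lemma countable_if_derived_set_has_outer_base:
  assumes X: "compact_space X" "Hausdorff_space X" and Z: "Z \<subseteq> topspace X" "Z \<inter> X derived_set_of Z = {}"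
    and \<E>: "countable_outer_base X (X derived_set_of Z) \<E>"
  shows "countable Z"
proof -
  define F where "F = X derived_set_of Z"
  have "compactin X F"
    unfolding F_def using X
    by (simp add: closedin_compact_space closedin_derived_set_of_gen Hausdorff_imp_t1_space)
  define \<O> where "\<O> = {\<F>. finite \<F> \<and> \<F> \<subseteq> \<E>} \<inter> {\<F>. F \<subseteq> \<Union>\<F>}"
  have "countable \<O>"
    unfolding \<O>_def using countable_outer_baseD(1) [OF \<E>]
    by (intro countable_Int1 countable_Collect_finite_subset)
  have fin: "finite (Z - \<Union>\<F>)" if "\<F> \<in> \<O>" for \<F>
  proof (rule ccontr)
    assume "infinite (Z - \<Union>\<F>)"
    then have "X derived_set_of (Z - \<Union>\<F>) \<noteq> {}"
      using compact_space_imp_Bolzano_Weierstrass [OF X(1)] Z(1) by blast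
    then obtain z where z: "z \<in> X derived_set_of (Z - \<Union>\<F>)" by blast
    then have "z \<in> F" using derived_set_of_mono [of "Z - \<Union>\<F>" Z X] unfolding F_def by blast
    then have "z \<in> \<Union>\<F>" using that by (auto simp: \<O>_def)
    moreover have "openin X (\<Union>\<F>)"
      using that countable_outer_baseD(2) [OF \<E>] by (intro openin_Union) (auto simp: \<O>_def)
    ultimately show False using z unfolding in_derived_set_of by blast
  qed
  have "\<exists>\<F>\<in>\<O>. z \<notin> \<Union>\<F>" if z: "z \<in> Z" for z
  proof -
    have zt: "z \<in> topspace X" "z \<notin> F" using z Z F_def by blast+
    define \<B> where "\<B> = {B \<in> \<E>. z \<notin> B}"
    have "F \<subseteq> \<Union>\<B>"
    proof
      fix x assume x: "x \<in> F"
      then have "x \<in> topspace X" 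
        using derived_set_of_subset_topspace [of X Z] unfolding F_def by blast
      moreover have "openin X (topspace X - {z})"
        using X(2) zt(1) by (simp add: Hausdorff_imp_t1_space closedin_t1_singleton openin_diff)
      ultimately obtain B where "B \<in> \<E>" "x \<in> B" "B \<subseteq> topspace X - {z}"
        using countable_outer_baseD(3) [OF \<E>, of x "topspace X - {z}"] x zt(2) unfolding F_def by blast
      then show "x \<in> \<Union>\<B>" unfolding \<B>_def by blast
    qed
    moreover have "openin X B" if "B \<in> \<B>" for B
      using that countable_outer_baseD(2) [OF \<E>] by (simp add: \<B>_def)
    ultimately have "\<exists>\<F>. finite \<F> \<and> \<F> \<subseteq> \<B> \<and> F \<subseteq> \<Union>\<F>"
      using compactinD [OF \<open>compactin X F\<close>, of \<B>] by simp
    then obtain \<F> where "finite \<F>" "\<F> \<subseteq> \<B>" "F \<subseteq> \<Union>\<F>" by (elim exE conjE)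
    then show ?thesis unfolding \<O>_def \<B>_def by (intro bexI [of _ \<F>]) blast+
  qed
  then have "Z \<subseteq> (\<Union>\<F>\<in>\<O>. Z - \<Union>\<F>)" by blast
  moreover have "countable (\<Union>\<F>\<in>\<O>. Z - \<Union>\<F>)"
    using \<open>countable \<O>\<close> by (rule countable_UN) (simp add: countable_finite fin)
  ultimately show ?thesis by (rule countable_subset)
qed

section \<open>Topological groups\<close>

context topological_group
begin

lemma inv_mult_cancel_left:
  assumes "a \<in> carrier G" "z \<in> carrier G"
  shows "inv a \<otimes> (a \<otimes> z) = z"
  using assms by (metis inv_closed l_inv l_one m_assoc)

lemma mult_inv_cancel_left:
  assumes "a \<in> carrier G" "z \<in> carrier G"
  shows "a \<otimes> (inv a \<otimes> z) = z"
  using assms by (metis inv_closed r_inv l_one m_assoc)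

lemma continuous_map_mult:
  assumes "continuous_map X T f" "continuous_map X T g"
  shows "continuous_map X T (\<lambda>x. f x \<otimes> g x)"
  using continuous_map_compose [OF continuous_map_pairedI [OF assms] continuous_mult] by (simp add: o_def)

lemma continuous_map_inverse:
  assumes "continuous_map X T f"
  shows "continuous_map X T (\<lambda>x. inv (f x))"
  using continuous_map_compose [OF assms continuous_inv] by (simp add: o_def)

lemma continuous_map_const_carrier:
  assumes "a \<in> carrier G"
  shows "continuous_map X T (\<lambda>x. a)"
  using assms by (simp add: topspace_eq_carrier)

lemma openin_preimage:
  assumes "continuous_map T T f" "openin T U"
  shows "openin T {x \<in> carrier G. f x \<in> U}"
  using openin_continuous_map_preimage [OF assms] by (simp add: topspace_eq_carrier)

lemma locally_compact_if_compact_neighbourhood: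
  assumes g: "g \<in> U" and U: "openin T U" "U \<subseteq> K" and K: "compactin T K"
  shows "locally_compact_space T"
  unfolding locally_compact_space_def
proof
  fix x assume "x \<in> topspace T"
  then have x: "x \<in> carrier G" by (simp add: topspace_eq_carrier)
  have gc: "g \<in> carrier G" using g openin_subset [OF U(1)] by (auto simp: topspace_eq_carrier)
  define f where "f y = (x \<otimes> inv g) \<otimes> y" for y
  define h where "h y = (g \<otimes> inv x) \<otimes> y" for y
  have hf: "f (h y) = y" if "y \<in> carrier G" for y
    using x gc that by (simp add: f_def h_def m_assoc inv_mult_cancel_left mult_inv_cancel_left)
  have "continuous_map T T f" "continuous_map T T h"
    unfolding f_def h_def using x gc
    by (intro continuous_map_mult continuous_map_const_carrier, simp_all)+
  show "\<exists>V L. openin T V \<and> compactin T L \<and> x \<in> V \<and> V \<subseteq> L"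
  proof (intro exI conjI)
    show "openin T {y \<in> carrier G. h y \<in> U}"
      using \<open>continuous_map T T h\<close> U(1) by (rule openin_preimage)
    show "compactin T (f ` K)"
      using K \<open>continuous_map T T f\<close> by (rule image_compactin)
    show "x \<in> {y \<in> carrier G. h y \<in> U}"
      using x gc g by (simp add: h_def m_assoc)
    show "{y \<in> carrier G. h y \<in> U} \<subseteq> f ` K"
    proof
      fix y assume "y \<in> {y \<in> carrier G. h y \<in> U}"
      then have "f (h y) = y" "h y \<in> K" using hf U(2) by auto
      then show "y \<in> f ` K" by (metis imageI)
    qed
  qed
qed

lemma neighbourhood_mult_inv:
  assumes "g \<in> carrier G" "openin T U" "\<one> \<in> U"
  shows "\<exists>W. openin T W \<and> g \<in> W \<and> (\<forall>x\<in>W. \<forall>y\<in>W. x \<otimes> inv y \<in> U)"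
proof -
  have "continuous_map (prod_topology T T) T (\<lambda>p. fst p \<otimes> inv (snd p))"
    by (intro continuous_map_mult continuous_map_inverse continuous_map_fst continuous_map_snd)
  then have "openin (prod_topology T T) {p \<in> topspace (prod_topology T T). fst p \<otimes> inv (snd p) \<in> U}"
    using assms(2) by (rule openin_continuous_map_preimage)
  moreover have "(g, g) \<in> {p \<in> topspace (prod_topology T T). fst p \<otimes> inv (snd p) \<in> U}"
    using assms by (simp add: topspace_eq_carrier)
  ultimately have "\<exists>A B. openin T A \<and> openin T B \<and> g \<in> A \<and> g \<in> B \<and>
      A \<times> B \<subseteq> {p \<in> topspace (prod_topology T T). fst p \<otimes> inv (snd p) \<in> U}"
    by (simp only: openin_prod_topology_alt)
  then obtain A B where AB: "openin T A" "openin T B" "g \<in> A" "g \<in> B"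
    "A \<times> B \<subseteq> {p \<in> topspace (prod_topology T T). fst p \<otimes> inv (snd p) \<in> U}"
    by (elim exE conjE)
  have "x \<otimes> inv y \<in> U" if "x \<in> A \<inter> B" "y \<in> A \<inter> B" for x y
  proof -
    have "(x, y) \<in> A \<times> B" using that by blast
    with AB(5) have "(x, y) \<in> {p \<in> topspace (prod_topology T T). fst p \<otimes> inv (snd p) \<in> U}" by (rule subsetD)
    then show ?thesis by simp
  qed
  moreover have "openin T (A \<inter> B)" "g \<in> A \<inter> B" using AB by auto
  ultimately show ?thesis by blast
qed

text \<open>In a topological group the \<open>\<pi>\<close>-character equals the character: if \<open>p \<in> P\<close> then \<open>P inv p\<close> is a
  neighbourhood of the identity, and it is small if \<open>P\<close> lies in a small neighbourhood of \<open>g\<close>.\<close>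

lemma countable_base_at_one_if_countable_pi_base:
  assumes "countable \<P>" and \<P>: "\<And>P. P \<in> \<P> \<Longrightarrow> openin T P \<and> P \<noteq> {}"
    and g: "g \<in> carrier G" and dense: "\<And>W. openin T W \<Longrightarrow> g \<in> W \<Longrightarrow> \<exists>P\<in>\<P>. P \<subseteq> W"
  shows "\<exists>\<V>. countable \<V> \<and> (\<forall>V\<in>\<V>. openin T V \<and> \<one> \<in> V) \<and> (\<forall>U. openin T U \<and> \<one> \<in> U \<longrightarrow> (\<exists>V\<in>\<V>. V \<subseteq> U))"
proof -
  have "\<forall>P\<in>\<P>. \<exists>p. p \<in> P" using \<P> by blast
  from bchoice [OF this] obtain p where p: "\<forall>P\<in>\<P>. p P \<in> P" ..
  have pc: "p P \<in> carrier G" if "P \<in> \<P>" for P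
    using p \<P> [OF that] that openin_subset [of T P] by (auto simp: topspace_eq_carrier)
  define V where "V P = {x \<in> carrier G. x \<otimes> p P \<in> P}" for P
  show ?thesis
  proof (intro exI [of _ "V ` \<P>"] conjI ballI allI impI)
    show "countable (V ` \<P>)" using assms(1) by simp
  next
    fix W assume "W \<in> V ` \<P>"
    then obtain P where P: "P \<in> \<P>" "W = V P" by blast
    have "continuous_map T T (\<lambda>x. x \<otimes> p P)"
      using pc [OF P(1)] by (intro continuous_map_mult continuous_map_const_carrier) simp_all
    then show "openin T W" unfolding P(2) V_def using \<P> [OF P(1)] by (intro openin_preimage) simp_all
    show "\<one> \<in> W" using p P pc [OF P(1)] by (simp add: V_def)
  next
    fix U assume "openin T U \<and> \<one> \<in> U"
    then obtain W where W: "openin T W" "g \<in> W" "\<forall>x\<in>W. \<forall>y\<in>W. x \<otimes> inv y \<in> U"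
      using neighbourhood_mult_inv [OF g] by blast
    then obtain P where P: "P \<in> \<P>" "P \<subseteq> W" using dense by blast
    have "V P \<subseteq> U"
    proof
      fix x assume "x \<in> V P"
      then have x: "x \<in> carrier G" "x \<otimes> p P \<in> W" using P(2) by (auto simp: V_def)
      moreover have "p P \<in> W" using p P by blast
      ultimately have "(x \<otimes> p P) \<otimes> inv (p P) \<in> U" using W(3) by blast
      then show "x \<in> U" using x(1) pc [OF P(1)] by (simp add: m_assoc)
    qed
    then show "\<exists>V\<in>V ` \<P>. V \<subseteq> U" using P(1) by blast
  qed
qed

lemma derived_set_of_separated_set:
  assumes V: "openin T V" "\<one> \<in> V" and Z: "pairwise (\<lambda>x y. x \<otimes> inv y \<notin> V) Z"
  shows "T derived_set_of Z = {}"
proof (rule ccontr)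
  assume "T derived_set_of Z \<noteq> {}"
  then obtain g where g: "g \<in> T derived_set_of Z" by blast
  then have "g \<in> carrier G"
    using derived_set_of_subset_topspace [of T Z] topspace_eq_carrier by blast
  then obtain W where W: "openin T W" "g \<in> W" "\<forall>x\<in>W. \<forall>y\<in>W. x \<otimes> inv y \<in> V"
    using neighbourhood_mult_inv [OF _ V] by blast
  have inf: "infinite (Z \<inter> W)"
    using Hausdorff_imp_t1_space [OF Hausdorff] g W(1,2) by (rule t1_derived_set_of_infinite)
  obtain a where a: "a \<in> Z \<inter> W"
    using infinite_imp_nonempty [OF inf] unfolding ex_in_conv [symmetric] ..
  obtain b where b: "b \<in> Z \<inter> W - {a}"
    using infinite_imp_nonempty [OF infinite_remove [OF inf]] unfolding ex_in_conv [symmetric] ..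
  show False
    using Z a b W(3) unfolding pairwise_def by blast
qed

text \<open>The union \<open>D\<close> of maximal \<open>V\<close>-separated sets, for \<open>V\<close> in a countable base at the identity, is a countable dense
  set, and the translates \<open>V d\<close> with \<open>d \<in> D\<close> form a base.\<close>

lemma second_countable_if_separated_sets_countable:
  assumes "countable \<V>" and \<V>: "\<forall>V\<in>\<V>. openin T V \<and> \<one> \<in> V"
    and base: "\<forall>U. openin T U \<and> \<one> \<in> U \<longrightarrow> (\<exists>V\<in>\<V>. V \<subseteq> U)"
    and sep: "\<And>V Z. V \<in> \<V> \<Longrightarrow> Z \<subseteq> carrier G \<Longrightarrow> pairwise (\<lambda>x y. x \<otimes> inv y \<notin> V) Z \<Longrightarrow> countable Z"
  shows "second_countable T"
proof -
  have "\<forall>V. \<exists>Z\<subseteq>carrier G. pairwise (\<lambda>x y. x \<otimes> inv y \<notin> V) Z \<and>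
          (\<forall>a\<in>carrier G - Z. \<exists>z\<in>Z. z \<otimes> inv a \<in> V \<or> a \<otimes> inv z \<in> V)"
    using maximal_independent_subset [of "carrier G" "\<lambda>x y. x \<otimes> inv y \<in> _"] by (rule allI)
  from choice [OF this] obtain Z where Z: "\<forall>V. Z V \<subseteq> carrier G \<and> pairwise (\<lambda>x y. x \<otimes> inv y \<notin> V) (Z V) \<and>
          (\<forall>a\<in>carrier G - Z V. \<exists>z\<in>Z V. z \<otimes> inv a \<in> V \<or> a \<otimes> inv z \<in> V)" ..
  define D where "D = (\<Union>V\<in>\<V>. Z V)"
  have Dc: "D \<subseteq> carrier G" using Z unfolding D_def by blast
  have "countable (Z V)" if "V \<in> \<V>" for V
    using sep [OF that] Z by simp
  with assms(1) have "countable D"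
    unfolding D_def by (rule countable_UN)
  define B where "B = (\<lambda>(d, V). {x \<in> carrier G. x \<otimes> inv d \<in> V})"
  have "\<exists>C\<in>B ` (D \<times> \<V>). x \<in> C \<and> C \<subseteq> U" if U: "openin T U" "x \<in> U" for U x
  proof -
    have x: "x \<in> carrier G" using U openin_subset [OF U(1)] by (auto simp: topspace_eq_carrier)
    define U0 where "U0 = {y \<in> carrier G. y \<otimes> x \<in> U}"
    have "continuous_map T T (\<lambda>y. y \<otimes> x)"
      using x by (intro continuous_map_mult continuous_map_const_carrier) simp_all
    then have "openin T U0" unfolding U0_def using U(1) by (rule openin_preimage)
    moreover have "\<one> \<in> U0" using x U(2) by (simp add: U0_def)
    ultimately obtain A where A: "openin T A" "\<one> \<in> A" "\<forall>a\<in>A. \<forall>b\<in>A. a \<otimes> inv b \<in> U0"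
      using neighbourhood_mult_inv [OF one_closed] by blast
    then obtain V where V: "V \<in> \<V>" "V \<subseteq> A" using base by blast
    have "openin T V" "\<one> \<in> V" using \<V> V(1) by simp_all
    then obtain A' where A': "openin T A'" "\<one> \<in> A'" "\<forall>a\<in>A'. \<forall>b\<in>A'. a \<otimes> inv b \<in> V"
      using neighbourhood_mult_inv [OF one_closed] by blast
    then obtain V' where V': "V' \<in> \<V>" "V' \<subseteq> A'" using base by blast
    have V'_1: "\<one> \<in> V'" and V'_c: "V' \<subseteq> carrier G"
      using \<V> V'(1) openin_subset [of T V'] topspace_eq_carrier by auto
    have "\<exists>d\<in>Z V'. x \<otimes> inv d \<in> V"
    proof (cases "x \<in> Z V'")
      case True
      then show ?thesis using x \<open>\<one> \<in> V\<close> by (intro bexI [of _ x]) simp_all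
    next
      case False
      with x Z obtain z where z: "z \<in> Z V'" "z \<otimes> inv x \<in> V' \<or> x \<otimes> inv z \<in> V'" by blast
      then have zc: "z \<in> carrier G" using Z by blast
      have "x \<otimes> inv z \<in> V"
        using z(2)
      proof
        assume "z \<otimes> inv x \<in> V'"
        then have "\<one> \<otimes> inv (z \<otimes> inv x) \<in> V" using A'(3) V'(2) V'_1 by blast
        then show ?thesis using x zc by (simp add: inv_mult_group)
      next
        assume "x \<otimes> inv z \<in> V'"
        then have "(x \<otimes> inv z) \<otimes> inv \<one> \<in> V" using A'(3) V'(2) V'_1 by blast
        then show ?thesis using x zc by simp
      qed
      with z(1) show ?thesis by blast
    qed
    then obtain d where d: "d \<in> Z V'" "x \<otimes> inv d \<in> V" by blast
    then have dD: "d \<in> D" and dc: "d \<in> carrier G" using V'(1) Dc unfolding D_def by blast+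
    have "B (d, V) \<subseteq> U"
    proof
      fix y assume "y \<in> B (d, V)"
      then have y: "y \<in> carrier G" "y \<otimes> inv d \<in> V" by (simp_all add: B_def)
      then have "(y \<otimes> inv d) \<otimes> inv (x \<otimes> inv d) \<in> U0" using A(3) V(2) d(2) by blast
      moreover have "(y \<otimes> inv d) \<otimes> inv (x \<otimes> inv d) = y \<otimes> inv x"
        using x y(1) dc by (simp add: inv_mult_group m_assoc inv_mult_cancel_left)
      ultimately have "y \<otimes> inv x \<otimes> x \<in> U" by (simp add: U0_def)
      then show "y \<in> U" using x y(1) by (simp add: m_assoc)
    qed
    moreover have "x \<in> B (d, V)" using x d(2) by (simp add: B_def)
    ultimately show ?thesis using dD V(1) by blast
  qed
  moreover have "countable (B ` (D \<times> \<V>))"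
    using \<open>countable D\<close> assms(1) by simp
  moreover have "openin T C" if C: "C \<in> B ` (D \<times> \<V>)" for C
  proof -
    obtain d V where dV: "d \<in> D" "V \<in> \<V>" "C = {x \<in> carrier G. x \<otimes> inv d \<in> V}"
      using C by (auto simp: B_def)
    have "continuous_map T T (\<lambda>y. y \<otimes> inv d)"
      using dV(1) Dc by (intro continuous_map_mult continuous_map_const_carrier) auto
    then show ?thesis unfolding dV(3) using \<V> dV(2) by (intro openin_preimage) simp_all
  qed
  ultimately show ?thesis
    unfolding second_countable_def by (intro exI [of _ "B ` (D \<times> \<V>)"]) simp
qed

end

section \<open>Compactifications and their remainders\<close>

lemma compact_network_compact_set:
  assumes "compactin X F" "S \<subseteq> F"
  shows "compact_network X S {F}"
  unfolding compact_network_def using assms by blast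

lemma compact_network_points:
  assumes "S \<subseteq> topspace X"
  shows "compact_network X S ((\<lambda>x. {x}) ` S)"
  unfolding compact_network_def
proof
  fix p assume "p \<in> S"
  with assms show "\<exists>P. p \<in> P \<and> compactin X P \<and>
      (\<forall>U. openin X U \<and> P \<subseteq> U \<longrightarrow> (\<exists>N\<in>(\<lambda>x. {x}) ` S. P \<subseteq> N \<and> N \<subseteq> U))"
    by (intro exI [of _ "{p}"]) auto
qed

text \<open>The compact set that belongs to \<open>y\<close> is the complement of the union of all basic sets that avoid \<open>y\<close>.
  It is disjoint from \<open>D\<close> because the basic sets form a base at each point of \<open>D\<close>, and it is
  approximated from outside by the complements of finite unions.\<close>

lemma compact_network_remainder:
  assumes X: "compact_space X" "Hausdorff_space X" and D: "D \<subseteq> topspace X"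
    and \<B>: "countable_outer_base X D \<B>"
  defines "Y \<equiv> topspace X - D"
  shows "compact_network (subtopology X Y) Y ((\<lambda>\<F>. Y - \<Union>\<F>) ` {\<F>. finite \<F> \<and> \<F> \<subseteq> \<B>})"
  unfolding compact_network_def
proof
  fix y assume y: "y \<in> Y"
  then have yt: "y \<in> topspace X" by (simp add: Y_def)
  define \<C> where "\<C> = {B \<in> \<B>. y \<notin> B}"
  define P where "P = topspace X - \<Union>\<C>"
  have C_open: "openin X B" if "B \<in> \<C>" for B
    using that countable_outer_baseD(2) [OF \<B>] by (simp add: \<C>_def)
  have "P \<subseteq> Y"
  proof
    fix x assume x: "x \<in> P"
    have "x \<notin> D"
    proof
      assume "x \<in> D"
      then have "x \<in> topspace X - {y}" using y D by (auto simp: Y_def)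
      moreover have "openin X (topspace X - {y})"
        using X(2) yt by (simp add: Hausdorff_imp_t1_space closedin_t1_singleton openin_diff)
      ultimately obtain B where "B \<in> \<B>" "x \<in> B" "B \<subseteq> topspace X - {y}"
        using countable_outer_baseD(3) [OF \<B> \<open>x \<in> D\<close>] by blast
      then have "x \<in> \<Union>\<C>" unfolding \<C>_def by blast
      with x show False by (simp add: P_def)
    qed
    with x show "x \<in> Y" by (simp add: P_def Y_def)
  qed
  have "openin X (\<Union>\<C>)" using C_open by (rule openin_Union)
  then have "compactin X P"
    unfolding P_def using X(1) by (intro closedin_compact_space closedin_diff closedin_topspace)
  show "\<exists>P. y \<in> P \<and> compactin (subtopology X Y) P \<and>
      (\<forall>U. openin (subtopology X Y) U \<and> P \<subseteq> U \<longrightarrow>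
         (\<exists>N\<in>(\<lambda>\<F>. Y - \<Union>\<F>) ` {\<F>. finite \<F> \<and> \<F> \<subseteq> \<B>}. P \<subseteq> N \<and> N \<subseteq> U))"
  proof (intro exI [of _ P] conjI allI impI)
    show "y \<in> P" using yt by (simp add: P_def \<C>_def)
    show "compactin (subtopology X Y) P"
      using \<open>compactin X P\<close> \<open>P \<subseteq> Y\<close> by (simp add: compactin_subtopology)
    fix U assume U: "openin (subtopology X Y) U \<and> P \<subseteq> U"
    then obtain U' where U': "openin X U'" "U = U' \<inter> Y"
      by (auto simp: openin_subtopology)
    have cover: "topspace X \<subseteq> \<Union>(insert U' \<C>)"
      using U U'(2) unfolding P_def by blast
    have opn: "openin X B" if "B \<in> insert U' \<C>" for B
      using that U'(1) C_open by blast
    have "\<exists>\<F>. finite \<F> \<and> \<F> \<subseteq> insert U' \<C> \<and> topspace X \<subseteq> \<Union>\<F>"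
      using X(1) [unfolded compact_space_def] opn cover by (rule compactinD)
    then obtain \<F> where \<F>: "finite \<F>" "\<F> \<subseteq> insert U' \<C>" "topspace X \<subseteq> \<Union>\<F>"
      by (elim exE conjE)
    define \<G> where "\<G> = \<F> - {U'}"
    have "\<G> \<subseteq> \<C>" "finite \<G>" using \<F> by (auto simp: \<G>_def)
    have "Y - \<Union>\<G> \<subseteq> U"
    proof
      fix x assume x: "x \<in> Y - \<Union>\<G>"
      then have "x \<in> \<Union>\<F>" using \<F>(3) by (auto simp: Y_def)
      with x have "x \<in> U'" unfolding \<G>_def by blast
      with x U'(2) show "x \<in> U" by blast
    qed
    moreover have "P \<subseteq> Y - \<Union>\<G>"
      using \<open>P \<subseteq> Y\<close> \<open>\<G> \<subseteq> \<C>\<close> unfolding P_def by blast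
    moreover have "\<G> \<in> {\<F>. finite \<F> \<and> \<F> \<subseteq> \<B>}"
      using \<open>\<G> \<subseteq> \<C>\<close> \<open>finite \<G>\<close> by (auto simp: \<C>_def)
    ultimately show "\<exists>N\<in>(\<lambda>\<F>. Y - \<Union>\<F>) ` {\<F>. finite \<F> \<and> \<F> \<subseteq> \<B>}. P \<subseteq> N \<and> N \<subseteq> U"
      by (intro bexI [of _ "Y - \<Union>\<G>"] conjI imageI)
  qed
qed

lemma open_subset_closure_of_Int_dense:
  assumes "openin X V" "X closure_of Y = topspace X"
  shows "V \<subseteq> X closure_of (V \<inter> Y)"
proof -
  have "V \<inter> X closure_of Y = V" using assms openin_subset [OF assms(1)] by auto
  moreover have "V \<subseteq> X closure_of V" using assms(1) by (simp add: closure_of_subset openin_subset)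
  ultimately show ?thesis
    using closure_of_openin_Int_closure_of [OF assms(1), of Y] by simp
qed

lemma open_meets_dense:
  assumes "openin X V" "X closure_of Y = topspace X" "V \<noteq> {}"
  shows "V \<inter> Y \<noteq> {}"
  using open_subset_closure_of_Int_dense [OF assms(1,2)] assms(3) by fastforce

lemma outer_base_in_compactification:
  assumes X: "compact_space X" "Hausdorff_space X" and Y: "X closure_of Y = topspace X"
    and loc: "has_locally has_delta_theta_base (subtopology X Y)"
    and \<N>: "countable \<N>" "compact_network (subtopology X Y) S \<N>" and S: "S \<subseteq> Y"
  shows "\<exists>\<E>. countable_outer_base X S \<E>"
proof -
  have "t1_space (subtopology X Y)"
    using X(2) by (simp add: Hausdorff_imp_t1_space t1_space_subtopology)
  then obtain \<E> where "countable_outer_base (subtopology X Y) S \<E>"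
    using countable_outer_base_of_compact_network [OF _ loc \<N>] by blast
  moreover have "regular_space X"
    using X by (simp add: compact_Hausdorff_imp_regular_space)
  ultimately show ?thesis
    using countable_outer_base_dense_extension [OF _ Y _ S] by blast
qed

text \<open>Otherwise a closed neighbourhood in \<open>Y\<close>, small enough to have a \<open>\<delta>\<theta>\<close>-base, would be
  compact. As \<open>Y\<close> is dense, this compact set would contain a nonempty open set of \<open>X\<close>, in contradiction to the density of the
  complement of \<open>Y\<close>.\<close>

lemma remainder_not_limit_point_compact:
  assumes X: "compact_space X" "Hausdorff_space X" and Y: "Y \<subseteq> topspace X" "X closure_of Y = topspace X"
    and D: "X closure_of (topspace X - Y) = topspace X" and "Y \<noteq> {}"
    and loc: "has_locally has_delta_theta_base (subtopology X Y)"
  shows "\<not> limit_point_compact_in (subtopology X Y) Y"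
proof
  assume lpc: "limit_point_compact_in (subtopology X Y) Y"
  have top: "topspace (subtopology X Y) = Y" using Y(1) by auto
  obtain y where "y \<in> Y" using \<open>Y \<noteq> {}\<close> by blast
  then have "\<exists>U. openin (subtopology X Y) U \<and> y \<in> U \<and> has_delta_theta_base (subtopology (subtopology X Y) U)"
    using loc top unfolding has_locally_def by simp
  then obtain U \<B> where U: "openin (subtopology X Y) U" "y \<in> U"
    and \<B>: "delta_theta_base (subtopology (subtopology X Y) U) \<B>"
    unfolding has_delta_theta_base_def by (elim exE conjE)
  have reg: "regular_space (subtopology X Y)"
    using X by (simp add: compact_Hausdorff_imp_regular_space regular_space_subtopology)
  have T1: "t1_space (subtopology (subtopology X Y) U)"
    using X(2) by (simp add: Hausdorff_imp_t1_space t1_space_subtopology)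
  obtain V where V: "openin (subtopology X Y) V" "y \<in> V" "(subtopology X Y) closure_of V \<subseteq> U"
    using regular_space_shrink [OF reg U] by blast
  define C where "C = (subtopology X Y) closure_of V"
  have C: "closedin (subtopology X Y) C" "V \<subseteq> C" "C \<subseteq> U" "C \<subseteq> Y"
    using V closure_of_subset [of V "subtopology X Y"] openin_subset [OF V(1)] openin_subset [OF U(1)] top
    by (auto simp: C_def)
  have "limit_point_compact_in (subtopology (subtopology X Y) U) C"
    unfolding limit_point_compact_in_def
  proof (intro allI impI)
    fix S assume S: "S \<subseteq> C" "infinite S"
    then have "Y \<inter> (subtopology X Y) derived_set_of S \<noteq> {}"
      using lpc C(4) unfolding limit_point_compact_in_def by blast
    then obtain z where z: "z \<in> (subtopology X Y) derived_set_of S" by blast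
    then have "z \<in> C"
      using C(1) derived_set_of_mono [OF S(1), of "subtopology X Y"] unfolding closedin_contains_derived_set by blast
    have "U \<inter> S = S" using S(1) C(3) by blast
    then have "z \<in> (subtopology (subtopology X Y) U) derived_set_of S"
      using z \<open>z \<in> C\<close> C(3) by (auto simp: derived_set_of_subtopology [of "subtopology X Y" U])
    with \<open>z \<in> C\<close> show "C \<inter> (subtopology (subtopology X Y) U) derived_set_of S \<noteq> {}" by blast
  qed
  moreover have "closedin (subtopology (subtopology X Y) U) C"
    using C(1,3) by (rule closedin_subset_topspace)
  ultimately have "compactin (subtopology (subtopology X Y) U) C"
    using limit_point_compact_delta_theta_base_imp_compactin [OF T1 \<B>] by blast
  then have "compactin X C" by (simp add: compactin_subtopology)
  then have "closedin X C" using X(2) by (rule compactin_imp_closedin [rotated])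
  obtain V' where V': "openin X V'" "V = V' \<inter> Y" using V(1) by (auto simp: openin_subtopology)
  have "V' \<subseteq> X closure_of (V' \<inter> Y)" using V'(1) Y(2) by (rule open_subset_closure_of_Int_dense)
  also have "\<dots> \<subseteq> C" using C(2) V'(2) \<open>closedin X C\<close> by (simp add: closure_of_minimal)
  finally have "V' \<inter> (topspace X - Y) = {}" using C(4) by blast
  moreover have "V' \<noteq> {}" using V(2) V'(2) by blast
  ultimately show False using open_meets_dense [OF V'(1) D] by blast
qed

context topological_group
begin

text \<open>A nonempty open set of \<open>bG\<close> inside \<open>G\<close> would provide a compact neighbourhood of one point of \<open>G\<close>,
  and by translation of every point.\<close>

lemma remainder_dense:
  assumes bG: "Hausdorff_compactification T bG" and nlc: "\<not> locally_compact_space T"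
  shows "bG closure_of (topspace bG - carrier G) = topspace bG"
proof (rule ccontr)
  assume "\<not> ?thesis"
  then have "\<exists>x. x \<in> topspace bG \<and> x \<notin> bG closure_of (topspace bG - carrier G)"
    using closure_of_subset_topspace [of bG "topspace bG - carrier G"] by blast
  then obtain x where x: "x \<in> topspace bG" "x \<notin> bG closure_of (topspace bG - carrier G)" by blast
  then obtain W where W: "openin bG W" "x \<in> W" "W \<inter> (topspace bG - carrier G) = {}"
    unfolding in_closure_of by blast
  then have WG: "W \<subseteq> carrier G" using openin_subset [OF W(1)] by blast
  have X: "compact_space bG" "Hausdorff_space bG" and T: "subtopology bG (carrier G) = T"
    using bG unfolding Hausdorff_compactification_def by (simp_all add: topspace_eq_carrier)
  obtain A where A: "openin bG A" "x \<in> A" "bG closure_of A \<subseteq> W"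
    using regular_space_shrink [OF compact_Hausdorff_imp_regular_space [OF X] W(1,2)] by blast
  have "compactin bG (bG closure_of A)"
    using X(1) by (simp add: closedin_compact_space)
  then have "compactin (subtopology bG (carrier G)) (bG closure_of A)"
    using A(3) WG unfolding compactin_subtopology by blast
  then have "compactin T (bG closure_of A)" by (simp add: T)
  have A_cl: "A \<subseteq> bG closure_of A" using A(1) by (simp add: closure_of_subset openin_subset)
  have "openin (subtopology bG (carrier G)) (carrier G \<inter> A)"
    using A(1) by (rule openin_subtopology_Int2)
  moreover have "carrier G \<inter> A = A" using A_cl A(3) WG by blast
  ultimately have "openin T A" by (simp add: T)
  with A(2) A_cl \<open>compactin T (bG closure_of A)\<close> have "locally_compact_space T"
    by (intro locally_compact_if_compact_neighbourhood)
  with nlc show False by contradiction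
qed

text \<open>An infinite set without limit points in the remainder has a limit point \<open>g\<close> in \<open>G\<close>. Each point of the
  remainder has a countable base in \<open>bG\<close>. The union of these bases for countably many points that accumulate at
  \<open>g\<close> is a countable \<open>\<pi>\<close>-base at \<open>g\<close>.\<close>

lemma countable_base_at_one:
  assumes bG: "Hausdorff_compactification T bG" and nlc: "\<not> locally_compact_space T"
    and loc: "has_locally has_delta_theta_base (subtopology bG (topspace bG - carrier G))"
  shows "\<exists>\<V>. countable \<V> \<and> (\<forall>V\<in>\<V>. openin T V \<and> \<one> \<in> V) \<and> (\<forall>U. openin T U \<and> \<one> \<in> U \<longrightarrow> (\<exists>V\<in>\<V>. V \<subseteq> U))"
proof -
  define Y where "Y = topspace bG - carrier G"
  have X: "compact_space bG" "Hausdorff_space bG" and G: "carrier G \<subseteq> topspace bG"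
    and G_dense: "bG closure_of carrier G = topspace bG" and T: "subtopology bG (carrier G) = T"
    using bG unfolding Hausdorff_compactification_def by (simp_all add: topspace_eq_carrier)
  have Y_dense: "bG closure_of Y = topspace bG"
    unfolding Y_def using bG nlc by (rule remainder_dense)
  have "topspace bG - Y = carrier G" using G by (auto simp: Y_def)
  have "Y \<noteq> {}" using Y_dense G one_closed by auto
  have "\<not> limit_point_compact_in (subtopology bG Y) Y"
  proof (rule remainder_not_limit_point_compact [OF X _ Y_dense])
    show "bG closure_of (topspace bG - Y) = topspace bG"
      using G_dense \<open>topspace bG - Y = carrier G\<close> by simp
  qed (use loc \<open>Y \<noteq> {}\<close> in \<open>auto simp: Y_def\<close>)
  then have "\<exists>S\<subseteq>Y. infinite S \<and> Y \<inter> (subtopology bG Y) derived_set_of S = {}"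
    unfolding limit_point_compact_in_def by blast
  then obtain S where S: "S \<subseteq> Y" "infinite S" "Y \<inter> (subtopology bG Y) derived_set_of S = {}"
    by (elim exE conjE)
  obtain Q where Q: "Q \<subseteq> S" "infinite Q" "countable Q"
    using infinite_countable_subset' [OF S(2)] by blast
  then have QY: "Q \<subseteq> Y" using S(1) by blast
  have "bG derived_set_of Q \<noteq> {}"
    using compact_space_imp_Bolzano_Weierstrass [OF X(1) Q(2)] QY by (auto simp: Y_def)
  then obtain g where g: "g \<in> bG derived_set_of Q" by blast
  have "g \<notin> Y"
  proof
    assume "g \<in> Y"
    moreover have "g \<in> bG derived_set_of S" using g derived_set_of_mono [OF Q(1), of bG] by blast
    moreover have "Y \<inter> S = S" using S(1) by blast
    ultimately have "g \<in> (subtopology bG Y) derived_set_of S"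
      by (simp add: derived_set_of_subtopology)
    with \<open>g \<in> Y\<close> S(3) show False by blast
  qed
  then have gG: "g \<in> carrier G"
    using g derived_set_of_subset_topspace [of bG Q] by (auto simp: Y_def)
  have "compact_network (subtopology bG Y) Q ((\<lambda>x. {x}) ` Q)"
    using QY by (intro compact_network_points) (auto simp: Y_def)
  moreover have "countable ((\<lambda>x. {x}) ` Q)" using Q(3) by simp
  ultimately obtain \<E> where \<E>: "countable_outer_base bG Q \<E>"
    using outer_base_in_compactification [OF X Y_dense _ _ _ QY] loc unfolding Y_def by blast
  show ?thesis
  proof (rule countable_base_at_one_if_countable_pi_base [OF _ _ gG])
    show "countable ((\<lambda>B. carrier G \<inter> B) ` (\<E> - {{}}))"
      using countable_outer_baseD(1) [OF \<E>] by simp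
    show "openin T P \<and> P \<noteq> {}" if P: "P \<in> (\<lambda>B. carrier G \<inter> B) ` (\<E> - {{}})" for P
    proof -
      obtain B where B: "B \<in> \<E>" "B \<noteq> {}" "P = carrier G \<inter> B" using P by blast
      then have "openin bG B" using countable_outer_baseD(2) [OF \<E>] by blast
      then have "openin (subtopology bG (carrier G)) P" unfolding B(3) by (rule openin_subtopology_Int2)
      moreover have "P \<noteq> {}"
        using open_meets_dense [OF \<open>openin bG B\<close> G_dense B(2)] B(3) by blast
      ultimately show ?thesis by (simp add: T)
    qed
    fix W assume W: "openin T W" "g \<in> W"
    then have "openin (subtopology bG (carrier G)) W" by (simp add: T)
    then obtain W' where W': "openin bG W'" "W = W' \<inter> carrier G" by (auto simp: openin_subtopology)
    then have "g \<in> W'" using W(2) by blast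
    then obtain q where q: "q \<in> Q" "q \<in> W'"
      using g W'(1) unfolding in_derived_set_of by blast
    then obtain B where B: "B \<in> \<E>" "q \<in> B" "B \<subseteq> W'"
      using countable_outer_baseD(3) [OF \<E> q(1) W'(1) q(2)] by blast
    then have "carrier G \<inter> B \<subseteq> W" "B \<in> \<E> - {{}}" using W'(2) by blast+
    then show "\<exists>P\<in>(\<lambda>B. carrier G \<inter> B) ` (\<E> - {{}}). P \<subseteq> W" by blast
  qed
qed

text \<open>All limit points of a separated set in \<open>bG\<close> lie in the remainder. They form a compact set there, and
  a compact subset of the remainder has a countable outer base.\<close>

lemma separated_set_countable:
  assumes bG: "Hausdorff_compactification T bG" and nlc: "\<not> locally_compact_space T"
    and loc: "has_locally has_delta_theta_base (subtopology bG (topspace bG - carrier G))"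
    and V: "openin T V" "\<one> \<in> V" and Z: "Z \<subseteq> carrier G" "pairwise (\<lambda>x y. x \<otimes> inv y \<notin> V) Z"
  shows "countable Z"
proof -
  define Y where "Y = topspace bG - carrier G"
  define F where "F = bG derived_set_of Z"
  have X: "compact_space bG" "Hausdorff_space bG" and G: "carrier G \<subseteq> topspace bG"
    and T: "subtopology bG (carrier G) = T"
    using bG unfolding Hausdorff_compactification_def by (simp_all add: topspace_eq_carrier)
  have Y_dense: "bG closure_of Y = topspace bG"
    unfolding Y_def using bG nlc by (rule remainder_dense)
  have "(subtopology bG (carrier G)) derived_set_of Z = {}"
    unfolding T using V Z(2) by (rule derived_set_of_separated_set)
  moreover have "carrier G \<inter> Z = Z" using Z(1) by blast
  ultimately have FG: "carrier G \<inter> F = {}"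
    unfolding F_def by (simp add: derived_set_of_subtopology)
  then have FY: "F \<subseteq> Y"
    using derived_set_of_subset_topspace [of bG Z] unfolding F_def Y_def by blast
  have "compactin bG F"
    unfolding F_def using X
    by (simp add: closedin_compact_space closedin_derived_set_of_gen Hausdorff_imp_t1_space)
  then have "compactin (subtopology bG Y) F" using FY by (simp add: compactin_subtopology)
  then have net: "compact_network (subtopology bG Y) F {F}"
    by (rule compact_network_compact_set) (rule order_refl)
  have "countable {F}" by simp
  then obtain \<E> where \<E>: "countable_outer_base bG F \<E>"
    using outer_base_in_compactification [OF X Y_dense _ _ net FY] loc unfolding Y_def by blast
  show ?thesis
  proof (rule countable_if_derived_set_has_outer_base [OF X])
    show "Z \<subseteq> topspace bG" using Z(1) G by blast
    show "Z \<inter> bG derived_set_of Z = {}" using FG Z(1) unfolding F_def by blast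
    show "countable_outer_base bG (bG derived_set_of Z) \<E>" using \<E> unfolding F_def .
  qed
qed

text \<open>A countable base of \<open>G\<close> first extends to a countable outer base of \<open>G\<close> in \<open>bG\<close>. This gives a countable network
  modulo compact sets for the whole remainder, and so a countable outer base of the remainder.\<close>

lemma second_countable_compactification:
  assumes bG: "Hausdorff_compactification T bG" and nlc: "\<not> locally_compact_space T"
    and loc: "has_locally has_delta_theta_base (subtopology bG (topspace bG - carrier G))"
  shows "second_countable bG"
proof -
  define Y where "Y = topspace bG - carrier G"
  have X: "compact_space bG" "Hausdorff_space bG" and G: "carrier G \<subseteq> topspace bG"
    and G_dense: "bG closure_of carrier G = topspace bG" and T: "subtopology bG (carrier G) = T"
    using bG unfolding Hausdorff_compactification_def by (simp_all add: topspace_eq_carrier)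
  have Y_dense: "bG closure_of Y = topspace bG"
    unfolding Y_def using bG nlc by (rule remainder_dense)
  obtain \<V> where \<V>: "countable \<V>" "\<forall>V\<in>\<V>. openin T V \<and> \<one> \<in> V"
    "\<forall>U. openin T U \<and> \<one> \<in> U \<longrightarrow> (\<exists>V\<in>\<V>. V \<subseteq> U)"
    using countable_base_at_one [OF bG nlc loc] by (elim exE conjE)
  have "second_countable T"
  proof (rule second_countable_if_separated_sets_countable [OF \<V>])
    show "countable Z" if "V \<in> \<V>" "Z \<subseteq> carrier G" "pairwise (\<lambda>x y. x \<otimes> inv y \<notin> V) Z" for V Z
      using \<V>(2) that by (intro separated_set_countable [OF bG nlc loc, of V]) simp_all
  qed
  then obtain \<C> where "countable \<C>" "\<forall>V\<in>\<C>. openin T V"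
    "\<forall>U x. openin T U \<and> x \<in> U \<longrightarrow> (\<exists>V\<in>\<C>. x \<in> V \<and> V \<subseteq> U)"
    unfolding second_countable_def by (elim exE conjE)
  then have "countable_outer_base (subtopology bG (carrier G)) (carrier G) \<C>"
    unfolding T countable_outer_base_def by simp
  then obtain \<B> where \<B>: "countable_outer_base bG (carrier G) \<B>"
    using countable_outer_base_dense_extension [OF compact_Hausdorff_imp_regular_space [OF X] G_dense _ order_refl]
    by blast
  have net: "compact_network (subtopology bG Y) Y ((\<lambda>\<F>. Y - \<Union>\<F>) ` {\<F>. finite \<F> \<and> \<F> \<subseteq> \<B>})"
    unfolding Y_def by (rule compact_network_remainder [OF X G \<B>])
  have "countable ((\<lambda>\<F>. Y - \<Union>\<F>) ` {\<F>. finite \<F> \<and> \<F> \<subseteq> \<B>})"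
    using countable_outer_baseD(1) [OF \<B>] by (intro countable_image countable_Collect_finite_subset)
  from outer_base_in_compactification [OF X Y_dense _ this net order_refl] loc
  obtain \<E> where \<E>: "countable_outer_base bG Y \<E>"
    unfolding Y_def by blast
  show ?thesis
    unfolding second_countable_def
  proof (intro exI [of _ "\<B> \<union> \<E>"] conjI ballI allI impI)
    show "countable (\<B> \<union> \<E>)"
      using countable_outer_baseD(1) [OF \<B>] countable_outer_baseD(1) [OF \<E>] by simp
    show "openin bG V" if "V \<in> \<B> \<union> \<E>" for V
      using that countable_outer_baseD(2) [OF \<B>] countable_outer_baseD(2) [OF \<E>] by blast
    fix U x assume U: "openin bG U \<and> x \<in> U"
    then have "x \<in> carrier G \<or> x \<in> Y" using openin_subset [of bG U] by (auto simp: Y_def)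
    then show "\<exists>V\<in>\<B> \<union> \<E>. x \<in> V \<and> V \<subseteq> U"
    proof
      assume "x \<in> carrier G"
      then show ?thesis using countable_outer_baseD(3) [OF \<B>, of x U] U by blast
    next
      assume "x \<in> Y"
      then show ?thesis using countable_outer_baseD(3) [OF \<E>, of x U] U by blast
    qed
  qed
qed

end

theorem theorem2p9:
  fixes G :: "('a, 'b) monoid_scheme" and T bG :: "'a topology"
  assumes "topological_group G T"
    and "\<not> locally_compact_space T"
    and "Hausdorff_compactification T bG"
    and "has_locally has_delta_theta_base (subtopology bG (topspace bG - carrier G))"
  shows "separable_space T \<and> metrizable_space T \<and> separable_space bG \<and> metrizable_space bG"
proof -
  have X: "compact_space bG" "Hausdorff_space bG" and T: "subtopology bG (topspace T) = T"
    using assms(3) unfolding Hausdorff_compactification_def by simp_all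
  have bG: "second_countable bG"
    using topological_group.second_countable_compactification [OF assms(1,3,2,4)] .
  then have "metrizable_space bG"
    using X by (intro compact_Hausdorff_second_countable_imp_metrizable)
  moreover from this have "metrizable_space T"
    using metrizable_space_subtopology [of bG "topspace T"] by (simp add: T)
  moreover have "second_countable T"
    using second_countable_subtopology [OF bG, of "topspace T"] by (simp add: T)
  ultimately show ?thesis
    using bG by (simp add: second_countable_imp_separable_space)
qed

end
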